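(* Let $d\ge 2$, let $\Lambda_0\subset\mathbb R^{d-1}$ be a lattice, let $H\subset\mathbb R^{d-1}$ be a nonempty finite set such that $\Lambda_0$ has the same symmetries as $H$ (in the sense defined in the context), and let $t>0$. For each bijection $b:\{1,\ldots,|H|\}\to H$ let $\mathbf s_b:\mathbb Z\to H$ be the $|H|$-periodic map with $\mathbf s_b|_{\{1,\ldots,|H|\}}=b$. For periodic $\mathbf s:\mathbb Z\to H$ let $\Lambda_{\mathbf s}$ be the layered configuration and $\mathcal E_\alpha(\Lambda_{\mathbf s})$ its average Gaussian energy per point, both defined in the context. Then the following hold. 1. If $\alpha\ge \frac{1}{2\pi t^2}$, then every $\mathbf s_b$ is a minimizer of $\mathbf s\mapsto \mathcal E_\alpha(\Lambda_{\mathbf s})$ amongst all periodic maps $\mathbf s:\mathbb Z\to H$. 2. If $\alpha> \frac{1}{2\pi t^2}$, then the $\mathbf s_b$ exhaust all minimizers among periodic layerings: if $\mathbf s:\mathbb Z\to H$ is periodic and minimizes $\mathcal E_\alpha(\Lambda_{\mathbf s})$ amongst periodic maps, then $\Lambda_{\mathbf s}=\Lambda_{\mathbf s_b}$ for some bijection $b$. 3. For all $\alpha>0$, the $\mathbf s_b$ minimize $\mathbf s\mapsto \mathcal E_\alpha(\Lambda_{\mathbf s})$ in the class $$\{\mathbf s:\mathbb Z\to H:\ \exists\, 1\le k'\le |H|,\ \exists\, b':\mathbb Z/k'\mathbb Z\to H,\ \mathbf s(i)=b'(i \bmod k')\ \text{for all } i\in\mathbb Z\},$$ namely amongst all layered configurations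 of period at most $|H|$.
   Context: A lattice in $\mathbb R^{d-1}$ is the $\mathbb Z$-span of a basis of $\mathbb R^{d-1}$. Same symmetries: $\Lambda_0$ has the same symmetries as $H$ if for any $x,y,w,z\in H$ with $x\ne y$ and $w\ne z$ there exists a bijection $\phi:\Lambda_0\to\Lambda_0$ such that $|p+x-y|=|\phi(p)+w-z|$ for all $p\in\Lambda_0$. Layered configuration: identify $\mathbb R^d=\mathbb R^{d-1}\times\mathbb R$. For $\mathbf s:\mathbb Z\to H$ set $$\Lambda_{\mathbf s}=\bigcup_{k\in\mathbb Z}\big\{(p+\mathbf s(k),\,kt):\ p\in\Lambda_0\big\}.$$ Average Gaussian energy per point: if $\mathbf s$ is periodic with period $P\geq 1$, $$\mathcal E_\alpha(\Lambda_{\mathbf s})=\frac1P\sum_{h=1}^P\sum_{k\in\mathbb Z}\sum_{p\in\Lambda_0}e^{-\pi\alpha\left((h-k)^2t^2+|p+\mathbf s(h)-\mathbf s(k)|^2\right)};$$ this value does not depend on the choice of the period $P$. *)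

theory Defs
  imports "HOL-Analysis.Analysis"
begin

definition is_lattice :: "'a::euclidean_space set \<Rightarrow> bool" where
  "is_lattice \<Lambda> \<longleftrightarrow>
     (\<exists>B. independent B \<and> span B = UNIV \<and>
          \<Lambda> = {\<Sum>b\<in>B. of_int (c b) *\<^sub>R b | c :: 'a \<Rightarrow> int. True})"

definition same_symmetries :: "'a::real_normed_vector set \<Rightarrow> 'a set \<Rightarrow> bool" where
  "same_symmetries \<Lambda> H \<longleftrightarrow>
     (\<forall>x\<in>H. \<forall>y\<in>H. \<forall>w\<in>H. \<forall>z\<in>H. x \<noteq> y \<longrightarrow> w \<noteq> z \<longrightarrow>
        (\<exists>\<phi>. bij_betw \<phi> \<Lambda> \<Lambda> \<and> (\<forall>p\<in>\<Lambda>. norm (p + x - y) = norm (\<phi> p + w - z))))"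

definition layered :: "'a::real_normed_vector set \<Rightarrow> real \<Rightarrow> (int \<Rightarrow> 'a) \<Rightarrow> ('a \<times> real) set" where
  "layered \<Lambda> t s = (\<Union>k. {(p + s k, of_int k * t) | p. p \<in> \<Lambda>})"

definition has_period :: "(int \<Rightarrow> 'a) \<Rightarrow> nat \<Rightarrow> bool" where
  "has_period s P \<longleftrightarrow> P \<ge> 1 \<and> (\<forall>i. s (i + int P) = s i)"

definition periodic_layering :: "'a set \<Rightarrow> (int \<Rightarrow> 'a) \<Rightarrow> bool" where
  "periodic_layering H s \<longleftrightarrow> range s \<subseteq> H \<and> (\<exists>P. has_period s P)"

text \<open>The layerings \<open>i \<mapsto> b' (i mod k')\<close> with \<open>b' : \<int>/k'\<int> \<rightarrow> H\<close>, \<open>1 \<le> k' \<le> |H|\<close>; a map on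
  \<open>\<int>/k'\<int>\<close> is given by its values at the representatives \<open>0, \<dots>, k' - 1\<close>.\<close>

definition short_layering :: "'a set \<Rightarrow> (int \<Rightarrow> 'a) \<Rightarrow> bool" where
  "short_layering H s \<longleftrightarrow>
     (\<exists>k'. 1 \<le> k' \<and> k' \<le> card H \<and>
        (\<exists>b'. b' ` {0..<int k'} \<subseteq> H \<and> (\<forall>i. s i = b' (i mod int k'))))"

text \<open>The \<open>n\<close>-periodic map that agrees with \<open>b\<close> on \<open>{1, \<dots>, n}\<close>.\<close>

definition periodic_ext :: "nat \<Rightarrow> (nat \<Rightarrow> 'a) \<Rightarrow> int \<Rightarrow> 'a" where
  "periodic_ext n b i = b (nat ((i - 1) mod int n) + 1)"

definition layer_energy ::
    "real \<Rightarrow> 'a::real_normed_vector set \<Rightarrow> real \<Rightarrow> (int \<Rightarrow> 'a) \<Rightarrow> int \<Rightarrow> real" where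
  "layer_energy \<alpha> \<Lambda> t s h =
     (\<Sum>\<^sub>\<infinity>k\<in>UNIV. \<Sum>\<^sub>\<infinity>p\<in>\<Lambda>.
        exp (- pi * \<alpha> * ((of_int (h - k))\<^sup>2 * t\<^sup>2 + (norm (p + s h - s k))\<^sup>2)))"

definition period_energy ::
    "real \<Rightarrow> 'a::real_normed_vector set \<Rightarrow> real \<Rightarrow> (int \<Rightarrow> 'a) \<Rightarrow> nat \<Rightarrow> real" where
  "period_energy \<alpha> \<Lambda> t s P = (1 / real P) * (\<Sum>h=1..int P. layer_energy \<alpha> \<Lambda> t s h)"

text \<open>The average Gaussian energy per point of \<open>layered \<Lambda> t s\<close>, for periodic \<open>s\<close>. The least period
  is only a choice: lemma \<open>energy_eq_period_energy\<close> below shows that every period gives the same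
  value.\<close>

definition energy :: "real \<Rightarrow> 'a::real_normed_vector set \<Rightarrow> real \<Rightarrow> (int \<Rightarrow> 'a) \<Rightarrow> real" where
  "energy \<alpha> \<Lambda> t s = period_energy \<alpha> \<Lambda> t s (LEAST P. has_period s P)"

lemma has_period_periodic_ext:
  assumes "n \<ge> 1"
  shows "has_period (periodic_ext n b) n"
proof -
  have "(i + int n - 1) mod int n = (i - 1) mod int n" for i
    by (metis add.commute add_diff_eq mod_add_self1)
  then show ?thesis
    using assms by (simp add: has_period_def periodic_ext_def)
qed

lemma periodic_ext_eq: "i \<in> {1..n} \<Longrightarrow> periodic_ext n b (int i) = b i"
  by (auto simp: periodic_ext_def nat_diff_distrib)

lemma layer_energy_shift:
  assumes "has_period s P"
  shows "layer_energy \<alpha> \<Lambda> t s (h + int P) = layer_energy \<alpha> \<Lambda> t s h"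
proof -
  have s: "s (i + int P) = s i" for i
    using assms by (simp add: has_period_def)
  have bij: "bij_betw (\<lambda>k. k + int P) UNIV UNIV"
    by (rule bij_betwI[where g = "\<lambda>k. k - int P"]) auto
  show ?thesis
    unfolding layer_energy_def
    by (subst infsum_reindex_bij_betw[OF bij, symmetric]) (simp add: s)
qed

lemma sum_periods:
  fixes g :: "int \<Rightarrow> real"
  assumes "\<And>h. g (h + int P) = g h"
  shows "(\<Sum>h=1..int (n * P). g h) = real n * (\<Sum>h=1..int P. g h)"
proof (induction n)
  case (Suc n)
  have shift: "g (h + int (n * P)) = g h" for h n
  proof (induction n)
    case (Suc n)
    have "g (h + int (Suc n * P)) = g ((h + int (n * P)) + int P)"
      by (simp add: algebra_simps)
    then show ?case
      using Suc assms by simp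
  qed simp
  have "int (Suc n * P) = int (n * P) + int P"
    by (simp add: algebra_simps)
  then have "{1..int (Suc n * P)} = {1..int (n * P)} \<union> {int (n * P) + 1..int (n * P) + int P}"
    by (simp only:) (auto simp del: of_nat_mult)
  then have "(\<Sum>h=1..int (Suc n * P). g h)
      = (\<Sum>h=1..int (n * P). g h) + (\<Sum>h=int (n * P) + 1..int (n * P) + int P. g h)"
    by (simp only:) (rule sum.union_disjoint; auto)
  also have "(\<Sum>h=int (n * P) + 1..int (n * P) + int P. g h) = (\<Sum>h=1..int P. g (h + int (n * P)))"
    by (rule sum.reindex_bij_witness[where i = "\<lambda>h. h + int (n * P)" and j = "\<lambda>h. h - int (n * P)"])
       auto
  also have "\<dots> = (\<Sum>h=1..int P. g h)"
    by (simp only: shift)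
  finally show ?case
    using Suc by (simp add: algebra_simps)
qed simp

lemma period_energy_unique:
  assumes "has_period s P" "has_period s Q"
  shows "period_energy \<alpha> \<Lambda> t s P = period_energy \<alpha> \<Lambda> t s Q"
proof -
  let ?g = "layer_energy \<alpha> \<Lambda> t s"
  have "real Q * (\<Sum>h=1..int P. ?g h) = (\<Sum>h=1..int (Q * P). ?g h)"
    by (rule sum_periods[symmetric]) (rule layer_energy_shift[OF assms(1)])
  also have "\<dots> = (\<Sum>h=1..int (P * Q). ?g h)"
    by (simp add: mult.commute)
  also have "\<dots> = real P * (\<Sum>h=1..int Q. ?g h)"
    by (rule sum_periods) (rule layer_energy_shift[OF assms(2)])
  finally show ?thesis
    using assms by (simp add: period_energy_def has_period_def field_simps)
qed

lemma energy_eq_period_energy: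
  "has_period s P \<Longrightarrow> energy \<alpha> \<Lambda> t s = period_energy \<alpha> \<Lambda> t s P"
  unfolding energy_def by (metis LeastI period_energy_unique)

end

theory Submission
  imports Defs
begin

text \<open>
  Let \<open>\<theta>(v) = \<Sum> exp (- \<pi> \<alpha> |p + v|\<^sup>2)\<close>, summed over the lattice. Two layers at vertical distance \<open>i t\<close>
  interact with the weight \<open>w i = exp (- a i\<^sup>2)\<close>, \<open>a = \<pi> \<alpha> t\<^sup>2\<close>, times \<open>\<theta>(x - y)\<close>, where \<open>x, y \<in> H\<close> are
  their shifts. Because the lattice has the same symmetries as \<open>H\<close>, this takes only the value \<open>\<theta>(0)\<close>
  for \<open>x = y\<close> and a common value \<open>c\<close> for \<open>x \<noteq> y\<close>. Hence the energy is an affine function, with slope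
  proportional to \<open>\<theta>(0) - c\<close>, of the coincidence energy: the sum of \<open>w\<close> over all pairs of layers with
  equal shifts (\<open>energy_eq_coincidence_energy\<close>). Two things remain.

  The slope is nonnegative, and positive unless all differences of points of \<open>H\<close> are lattice points,
  in which case all layered configurations coincide. Rotating pairs of lattice points by
  \<open>(p, q) \<mapsto> (p + q, p - q)\<close> and sorting them by classes modulo \<open>2 \<Lambda>\<close> shows that
  \<open>\<theta>(0)\<^sup>2 + \<theta>(0) \<theta>(2 v) - 2 \<theta>(v)\<^sup>2\<close> is a sum of squares (\<open>theta_doubling\<close>), so the bounded function
  \<open>\<theta>\<close> cannot exceed \<open>\<theta>(0)\<close>; and equality at \<open>v\<close> is inherited by the theta functions with \<open>\<alpha>\<close> replaced by
  \<open>2\<^sup>k \<alpha>\<close>, which is impossible for large \<open>k\<close> unless \<open>v\<close> is a lattice point.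

  The coincidence energy is minimal when any \<open>n = |H|\<close> consecutive layers have different shifts. For
  \<open>a \<ge> 1 / 2\<close> the sequence \<open>w 1, w 2, \<dots>\<close> is strictly convex, hence a superposition with positive
  coefficients of the tents \<open>i \<mapsto> max (L - i) 0\<close>, \<open>L \<ge> 2\<close>. The energy for a tent counts the equally
  shifted pairs in all windows of \<open>L\<close> consecutive layers (\<open>coincidence_energy_eq_windows\<close>), and a
  window has the fewest such pairs when the shifts are distributed as evenly as possible. The
  layerings \<open>s\<^sub>b\<close> achieve this in all windows simultaneously (\<open>coincidence_energy_min\<close>); for \<open>L = n\<close>
  evenness means absence of repetitions, which characterises the \<open>s\<^sub>b\<close>. If instead the period \<open>k\<close> is
  at most \<open>n\<close>, coincidences at all multiples of \<open>k\<close> are unavoidable and monotonicity of \<open>w\<close> suffices,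
  for every \<open>\<alpha> > 0\<close> (\<open>coincidence_energy_min_short\<close>).
\<close>

section \<open>Gaussian sums over a lattice\<close>

text \<open>Nonnegativity is what makes the double family summable, so that iterating the two sums is
  legitimate.\<close>

lemma has_sum_Times_mult:
  fixes f :: "'a \<Rightarrow> real" and g :: "'b \<Rightarrow> real"
  assumes f: "(f has_sum x) A" and g: "(g has_sum y) B"
    and "\<And>a. a \<in> A \<Longrightarrow> f a \<ge> 0" "\<And>b. b \<in> B \<Longrightarrow> g b \<ge> 0"
  shows "((\<lambda>(a, b). f a * g b) has_sum (x * y)) (A \<times> B)"
proof (rule has_sum_SigmaI)
  show sum: "((\<lambda>b. case (a, b) of (a, b) \<Rightarrow> f a * g b) has_sum (f a * y)) B" for a
    using has_sum_cmult_right[OF g] by simp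
  show outer: "((\<lambda>a. f a * y) has_sum (x * y)) A"
    by (rule has_sum_cmult_left[OF f])
  show "(\<lambda>(a, b). f a * g b) summable_on (A \<times> B)"
    using assms by (intro summable_on_SigmaI[OF sum has_sum_imp_summable[OF outer]]) auto
qed

lemma gaussian_summable_int:
  fixes a :: real
  assumes "a > 0"
  shows "(\<lambda>i::int. exp (- (a * (of_int i)\<^sup>2))) summable_on UNIV"
proof -
  have nat: "(\<lambda>n. exp (- (a * (real n)\<^sup>2))) summable_on UNIV"
  proof (rule summable_nonneg_imp_summable_on)
    show "summable (\<lambda>n. exp (- (a * (real n)\<^sup>2)))"
    proof (rule summable_comparison_test'[where g = "\<lambda>n. exp (- a) ^ n"])
      show "summable (\<lambda>n. exp (- a) ^ n)"
        using assms by (intro summable_geometric) simp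
      show "norm (exp (- (a * (real n)\<^sup>2))) \<le> exp (- a) ^ n" for n
      proof -
        have "real n \<le> (real n)\<^sup>2"
          by (cases n) (auto simp: power2_eq_square)
        then show ?thesis
          using assms by (simp add: exp_of_nat_mult[symmetric])
      qed
    qed
  qed simp
  have "(\<lambda>i::int. exp (- (a * (of_int i)\<^sup>2))) summable_on (range int \<union> range (\<lambda>n. - int n))"
    by (intro summable_on_union)
      (use nat in \<open>auto simp: summable_on_reindex inj_on_def o_def\<close>)
  moreover have "i \<in> range int \<union> range (\<lambda>n. - int n)" for i
    by (cases i rule: int_cases2) auto
  then have "range int \<union> range (\<lambda>n. - int n) = UNIV"
    by blast
  ultimately show ?thesis
    by metis
qed

lemma is_lattice_props:
  assumes "is_lattice \<Lambda>"
  shows lattice_0: "0 \<in> \<Lambda>"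
    and lattice_add: "\<And>x y. x \<in> \<Lambda> \<Longrightarrow> y \<in> \<Lambda> \<Longrightarrow> x + y \<in> \<Lambda>"
    and lattice_diff: "\<And>x y. x \<in> \<Lambda> \<Longrightarrow> y \<in> \<Lambda> \<Longrightarrow> x - y \<in> \<Lambda>"
proof -
  obtain B where L: "\<Lambda> = {\<Sum>b\<in>B. of_int (c b) *\<^sub>R b | c :: 'a \<Rightarrow> int. True}"
    using assms unfolding is_lattice_def by blast
  show "0 \<in> \<Lambda>"
    unfolding L by (rule CollectI, rule exI[of _ "\<lambda>_. 0"]) simp
  fix x y assume "x \<in> \<Lambda>" "y \<in> \<Lambda>"
  then obtain c d :: "'a \<Rightarrow> int" where
    xy: "x = (\<Sum>b\<in>B. of_int (c b) *\<^sub>R b)" "y = (\<Sum>b\<in>B. of_int (d b) *\<^sub>R b)"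
    unfolding L by blast
  show "x + y \<in> \<Lambda>"
    unfolding L xy
    by (rule CollectI, rule exI[of _ "\<lambda>b. c b + d b"]) (simp add: sum.distrib scaleR_add_left)
  show "x - y \<in> \<Lambda>"
    unfolding L xy
    by (rule CollectI, rule exI[of _ "\<lambda>b. c b - d b"]) (simp add: sum_subtractf scaleR_diff_left)
qed

text \<open>In finite dimension each coordinate functional of a basis is bounded, so the squared norm controls
  the sum of the squared coordinates.\<close>

lemma coordinates_bounded:
  fixes B :: "'a::euclidean_space set"
  assumes B: "independent B"
  obtains K where "K > 0"
    "\<And>c :: 'a \<Rightarrow> real. (\<Sum>b\<in>B. (c b)\<^sup>2) \<le> K * (norm (\<Sum>b\<in>B. c b *\<^sub>R b))\<^sup>2"
proof -
  have fin: "finite B"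
    using B by (rule independent_imp_finite)
  have "\<exists>g::'a \<Rightarrow> real. linear g \<and> (\<forall>x\<in>B. g x = (if x = b then 1 else 0))" for b
    by (rule linear_independent_extend[OF B])
  then obtain g :: "'a \<Rightarrow> 'a \<Rightarrow> real" where g: "\<And>b. linear (g b)"
    "\<And>b x. x \<in> B \<Longrightarrow> g b x = (if x = b then 1 else 0)"
    by metis
  have "\<exists>M>0. \<forall>x. norm (g b x) \<le> M * norm x" for b
    using linear_bounded_pos[OF g(1)] by metis
  then obtain M where M: "\<And>b. M b > 0" "\<And>b x. \<bar>g b x\<bar> \<le> M b * norm x"
    unfolding real_norm_def by metis
  define K where "K = 1 + (\<Sum>b\<in>B. (M b)\<^sup>2)"
  show ?thesis
  proof
    show "K > 0"
      unfolding K_def by (simp add: add_pos_nonneg sum_nonneg)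
    fix c :: "'a \<Rightarrow> real"
    let ?v = "\<Sum>b\<in>B. c b *\<^sub>R b"
    have "(c b)\<^sup>2 \<le> (M b)\<^sup>2 * (norm ?v)\<^sup>2" if "b \<in> B" for b
    proof -
      have "g b ?v = (\<Sum>x\<in>B. c x * g b x)"
        by (simp add: linear_sum[OF g(1)] linear_cmul[OF g(1)])
      also have "\<dots> = (\<Sum>x\<in>B. if x = b then c x else 0)"
        by (intro sum.cong) (auto simp: g(2))
      also have "\<dots> = c b"
        using fin that by simp
      finally have "\<bar>c b\<bar> \<le> M b * norm ?v"
        using M(2)[of b ?v] by simp
      then show ?thesis
        by (metis abs_ge_zero power2_abs power_mono power_mult_distrib)
    qed
    then have "(\<Sum>b\<in>B. (c b)\<^sup>2) \<le> (\<Sum>b\<in>B. (M b)\<^sup>2 * (norm ?v)\<^sup>2)"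
      by (rule sum_mono)
    also have "\<dots> \<le> K * (norm ?v)\<^sup>2"
      by (simp add: K_def sum_distrib_right[symmetric] mult_right_mono)
    finally show "(\<Sum>b\<in>B. (c b)\<^sup>2) \<le> K * (norm ?v)\<^sup>2" .
  qed
qed

text \<open>In coordinates the Gaussian of a lattice point is dominated by a product of one-dimensional
  Gaussians, and a product of convergent sums over \<open>\<int>\<close> converges over the integer tuples.\<close>

lemma gaussian_summable_centred:
  assumes "is_lattice \<Lambda>" "a > 0"
  shows "(\<lambda>p. exp (- (a * (norm p)\<^sup>2))) summable_on \<Lambda>"
proof -
  obtain B where B: "independent B"
    and L: "\<Lambda> = {\<Sum>b\<in>B. of_int (c b) *\<^sub>R b | c :: 'a \<Rightarrow> int. True}"
    using assms unfolding is_lattice_def by blast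
  have fin: "finite B"
    using B by (rule independent_imp_finite)
  obtain K where K: "K > 0"
    "\<And>c :: 'a \<Rightarrow> real. (\<Sum>b\<in>B. (c b)\<^sup>2) \<le> K * (norm (\<Sum>b\<in>B. c b *\<^sub>R b))\<^sup>2"
    using coordinates_bounded[OF B] by blast
  define D where "D = (\<Pi>\<^sub>E b\<in>B. (UNIV :: int set))"
  define \<psi> where "\<psi> c = (\<Sum>b\<in>B. real_of_int (c b) *\<^sub>R b)" for c
  let ?g = "\<lambda>i::int. exp (- (a / K * (of_int i)\<^sup>2))"
  have g: "?g summable_on UNIV"
    using assms K by (intro gaussian_summable_int) simp
  have inj: "inj_on \<psi> D"
  proof (rule inj_onI)
    fix c d assume cd: "c \<in> D" "d \<in> D" and eq: "\<psi> c = \<psi> d"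
    have "(\<Sum>b\<in>B. (real_of_int (c b) - of_int (d b)) *\<^sub>R b) = 0"
      using eq by (simp add: \<psi>_def scaleR_diff_left sum_subtractf)
    then have "(\<Sum>b\<in>B. (real_of_int (c b) - of_int (d b))\<^sup>2) \<le> 0"
      using K(2)[of "\<lambda>b. real_of_int (c b) - of_int (d b)"] by simp
    then have "(\<Sum>b\<in>B. (real_of_int (c b) - of_int (d b))\<^sup>2) = 0"
      by (simp add: antisym sum_nonneg)
    then have "\<forall>b\<in>B. (real_of_int (c b) - of_int (d b))\<^sup>2 = 0"
      using fin by (subst (asm) sum_nonneg_eq_0_iff) auto
    then show "c = d"
      using cd unfolding D_def by (intro PiE_ext) auto
  qed
  have img: "\<Lambda> = \<psi> ` D"
  proof -
    have "(\<Sum>b\<in>B. of_int (c b) *\<^sub>R b) = \<psi> (restrict c B)" for c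
      by (simp add: \<psi>_def)
    moreover have "restrict c B \<in> D" for c
      by (simp add: D_def)
    ultimately have "(\<Sum>b\<in>B. of_int (c b) *\<^sub>R b) \<in> \<psi> ` D" for c
      by (metis imageI)
    then show ?thesis
      unfolding L by (auto simp: \<psi>_def)
  qed
  have "(\<lambda>c. \<Prod>b\<in>B. ?g (c b)) summable_on D"
  proof (rule ccontr)
    \<comment> \<open>A divergent infinite sum has the value 0, whereas the product formula gives a product of
      positive numbers.\<close>
    assume "\<not> ?thesis"
    then have "infsum (\<lambda>c. \<Prod>b\<in>B. ?g (c b)) D = 0"
      by (rule infsum_not_exists)
    moreover have "infsum (\<lambda>c. \<Prod>b\<in>B. ?g (c b)) D = (\<Prod>b\<in>B. infsum ?g UNIV)"
      unfolding D_def using fin g by (intro infsum_prod_PiE_abs) auto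
    moreover have "infsum ?g UNIV > 0"
      using finite_sum_le_infsum[OF g, of "{0}"] by simp
    ultimately show False
      by simp
  qed
  moreover have "exp (- (a * (norm (\<psi> c))\<^sup>2)) \<le> (\<Prod>b\<in>B. ?g (c b))" for c
  proof -
    have "a / K * (\<Sum>b\<in>B. (real_of_int (c b))\<^sup>2) \<le> a / K * (K * (norm (\<psi> c))\<^sup>2)"
      unfolding \<psi>_def using assms K by (intro mult_left_mono K(2)) auto
    then show ?thesis
      using K(1) by (simp add: exp_sum[OF fin, symmetric] sum_negf sum_distrib_left)
  qed
  ultimately have "(\<lambda>c. exp (- (a * (norm (\<psi> c))\<^sup>2))) summable_on D"
    by (rule summable_on_comparison_test) auto
  then show ?thesis
    unfolding img summable_on_reindex[OF inj] by (simp add: o_def)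
qed

text \<open>The Gaussian energy of the shifted lattice seen from the origin; a Riemann theta function of
  \<open>v\<close>, periodic with respect to the lattice.\<close>

definition theta :: "'a::real_normed_vector set \<Rightarrow> real \<Rightarrow> 'a \<Rightarrow> real" where
  "theta \<Lambda> a v = (\<Sum>\<^sub>\<infinity>p\<in>\<Lambda>. exp (- (a * (norm (p + v))\<^sup>2)))"

text \<open>From \<open>|p|\<^sup>2 \<le> 2 |p + v|\<^sup>2 + 2 |v|\<^sup>2\<close>: half of the decay pays for the shift, at a cost that depends
  only on the size of \<open>v\<close>.\<close>

lemma gaussian_shift_le:
  fixes p v :: "'a::real_normed_vector"
  assumes "a > 0"
  shows "exp (- (a * (norm (p + v))\<^sup>2))
    \<le> exp (a * (norm v)\<^sup>2) * exp (- (a / 2 * (norm p)\<^sup>2))"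
proof -
  have "norm p \<le> norm (p + v) + norm v"
    using norm_triangle_ineq4[of "p + v" v] by simp
  then have "(norm p)\<^sup>2 \<le> (norm (p + v) + norm v)\<^sup>2"
    by (intro power_mono) auto
  also have "\<dots> \<le> 2 * (norm (p + v))\<^sup>2 + 2 * (norm v)\<^sup>2"
    using sum_squares_bound[of "norm (p + v)" "norm v"] by (simp add: power2_sum)
  finally have "a * (norm p)\<^sup>2 \<le> a * (2 * (norm (p + v))\<^sup>2 + 2 * (norm v)\<^sup>2)"
    using assms by (intro mult_left_mono) auto
  then show ?thesis
    by (simp add: exp_add[symmetric] algebra_simps)
qed

lemma gaussian_summable:
  assumes "is_lattice \<Lambda>" "a > 0"
  shows "(\<lambda>p. exp (- (a * (norm (p + v))\<^sup>2))) summable_on \<Lambda>"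
proof (rule summable_on_comparison_test)
  show "(\<lambda>p. exp (a * (norm v)\<^sup>2) * exp (- (a / 2 * (norm p)\<^sup>2))) summable_on \<Lambda>"
    using assms by (intro summable_on_cmult_right gaussian_summable_centred) auto
qed (use gaussian_shift_le[OF assms(2)] in auto)

lemma theta_has_sum:
  assumes "is_lattice \<Lambda>" "a > 0"
  shows "((\<lambda>p. exp (- (a * (norm (p + v))\<^sup>2))) has_sum theta \<Lambda> a v) \<Lambda>"
  unfolding theta_def using gaussian_summable[OF assms] by (rule has_sum_infsum)

lemma theta_nonneg: "theta \<Lambda> a v \<ge> 0"
  unfolding theta_def by (rule infsum_nonneg) simp

lemma theta_0_ge_1:
  assumes "is_lattice \<Lambda>" "a > 0"
  shows "theta \<Lambda> a 0 \<ge> 1"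
  using finite_sum_le_infsum[OF gaussian_summable[OF assms], of "{0}" 0] lattice_0[OF assms(1)]
  by (simp add: theta_def)

lemma bij_betw_lattice_shift:
  assumes "is_lattice \<Lambda>" "q \<in> \<Lambda>"
  shows "bij_betw (\<lambda>p. p + q) \<Lambda> \<Lambda>"
  using assms by (intro bij_betwI[where g = "\<lambda>p. p - q"]) (auto intro: lattice_add lattice_diff)

lemma theta_periodic:
  assumes "is_lattice \<Lambda>" "q \<in> \<Lambda>"
  shows "theta \<Lambda> a (q + v) = theta \<Lambda> a v"
  using infsum_reindex_bij_betw[OF bij_betw_lattice_shift[OF assms],
      of "\<lambda>p. exp (- (a * (norm (p + v))\<^sup>2))"]
  by (simp add: theta_def add.assoc)

text \<open>Round the coordinates of \<open>v\<close> down to integers.\<close>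

lemma lattice_cobounded:
  assumes "is_lattice \<Lambda>"
  obtains R where "\<And>v. \<exists>q\<in>\<Lambda>. norm (v - q) \<le> R"
proof -
  obtain B where B: "independent B" "span B = UNIV"
    and L: "\<Lambda> = {\<Sum>b\<in>B. of_int (c b) *\<^sub>R b | c :: 'a \<Rightarrow> int. True}"
    using assms unfolding is_lattice_def by blast
  have fin: "finite B"
    using B(1) by (rule independent_imp_finite)
  have "\<exists>q\<in>\<Lambda>. norm (v - q) \<le> (\<Sum>b\<in>B. norm b)" for v
  proof -
    have "v \<in> span B"
      using B by simp
    then obtain r where v: "v = (\<Sum>b\<in>B. r b *\<^sub>R b)"
      unfolding span_finite[OF fin] by auto
    let ?q = "\<Sum>b\<in>B. of_int \<lfloor>r b\<rfloor> *\<^sub>R b"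
    have "norm (v - ?q) = norm (\<Sum>b\<in>B. (r b - of_int \<lfloor>r b\<rfloor>) *\<^sub>R b)"
      by (simp add: v scaleR_diff_left sum_subtractf)
    also have "\<dots> \<le> (\<Sum>b\<in>B. norm ((r b - of_int \<lfloor>r b\<rfloor>) *\<^sub>R b))"
      by (rule norm_sum)
    also have "\<dots> \<le> (\<Sum>b\<in>B. norm b)"
    proof (rule sum_mono)
      fix b
      have "\<bar>r b - of_int \<lfloor>r b\<rfloor>\<bar> \<le> 1"
        by linarith
      then show "norm ((r b - of_int \<lfloor>r b\<rfloor>) *\<^sub>R b) \<le> norm b"
        using mult_right_mono[of "\<bar>r b - of_int \<lfloor>r b\<rfloor>\<bar>" 1 "norm b"] by simp
    qed
    finally have "norm (v - ?q) \<le> (\<Sum>b\<in>B. norm b)" .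
    moreover have "?q \<in> \<Lambda>"
      unfolding L by (rule CollectI, rule exI[of _ "\<lambda>b. \<lfloor>r b\<rfloor>"]) simp
    ultimately show ?thesis
      by (rule rev_bexI[rotated])
  qed
  then show ?thesis
    using that by blast
qed

text \<open>By periodicity \<open>v\<close> may be taken in a bounded region, where \<open>gaussian_shift_le\<close> is uniform.\<close>

lemma theta_bounded:
  assumes "is_lattice \<Lambda>" "a > 0"
  obtains M where "\<And>v. theta \<Lambda> a v \<le> M"
proof -
  obtain R where R: "\<And>v. \<exists>q\<in>\<Lambda>. norm (v - q) \<le> R"
    using lattice_cobounded[OF assms(1)] by blast
  have half: "a / 2 > 0"
    using assms by simp
  have "theta \<Lambda> a v \<le> exp (a * R\<^sup>2) * theta \<Lambda> (a / 2) 0" for v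
  proof -
    obtain q where q: "q \<in> \<Lambda>" "norm (v - q) \<le> R"
      using R by blast
    have "theta \<Lambda> a v = theta \<Lambda> a (v - q)"
      using theta_periodic[OF assms(1) q(1), of a "v - q"] by simp
    also have "\<dots> \<le> exp (a * (norm (v - q))\<^sup>2) * theta \<Lambda> (a / 2) 0"
      by (rule has_sum_mono[OF theta_has_sum[OF assms]
            has_sum_cmult_right[OF theta_has_sum[OF assms(1) half, of 0]]])
        (use gaussian_shift_le[OF assms(2)] in simp)
    also have "\<dots> \<le> exp (a * R\<^sup>2) * theta \<Lambda> (a / 2) 0"
      using assms q(2) by (intro mult_right_mono theta_nonneg) (auto intro: power_mono)
    finally show ?thesis .
  qed
  then show ?thesis
    using that by blast
qed

section \<open>The theta function is largest exactly at the lattice points\<close>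

text \<open>A system of representatives of \<open>\<Lambda> / 2 \<Lambda>\<close>.\<close>

lemma lattice_half_transversal:
  assumes "is_lattice \<Lambda>"
  obtains R where "R \<subseteq> \<Lambda>"
    and "\<forall>p\<in>\<Lambda>. \<exists>r\<in>R. \<exists>m\<in>\<Lambda>. p = r + 2 *\<^sub>R m"
    and "\<forall>r\<in>R. \<forall>r'\<in>R. \<forall>m\<in>\<Lambda>. r = r' + 2 *\<^sub>R m \<longrightarrow> r = r'"
proof -
  define cls where "cls p = {q \<in> \<Lambda>. \<exists>m\<in>\<Lambda>. p = q + 2 *\<^sub>R m}" for p
  define rep where "rep p = (SOME q. q \<in> cls p)" for p
  have self: "p \<in> cls p" if "p \<in> \<Lambda>" for p
    using that lattice_0[OF assms] by (force simp: cls_def)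
  have rep: "rep p \<in> cls p" if "p \<in> \<Lambda>" for p
    unfolding rep_def using self[OF that] by (rule someI)
  have eq: "cls p = cls q" if pq: "p = q + 2 *\<^sub>R m" "m \<in> \<Lambda>" for p q m
  proof -
    have "\<exists>l\<in>\<Lambda>. p = x + 2 *\<^sub>R l" if "k \<in> \<Lambda>" "q = x + 2 *\<^sub>R k" for x k
      using that pq lattice_add[OF assms, of k m]
      by (intro bexI[of _ "k + m"]) (auto simp: scaleR_add_right algebra_simps)
    moreover have "\<exists>l\<in>\<Lambda>. q = x + 2 *\<^sub>R l" if "k \<in> \<Lambda>" "p = x + 2 *\<^sub>R k" for x k
      using that pq lattice_diff[OF assms, of k m]
      by (intro bexI[of _ "k - m"]) (auto simp: scaleR_diff_right algebra_simps)
    ultimately show ?thesis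
      unfolding cls_def by blast
  qed
  have cls_rep: "cls (rep p) = cls p" if "p \<in> \<Lambda>" for p
    using rep[OF that] eq unfolding cls_def by blast
  show ?thesis
  proof
    show "rep ` \<Lambda> \<subseteq> \<Lambda>"
      using rep by (auto simp: cls_def)
    show "\<forall>p\<in>\<Lambda>. \<exists>r\<in>rep ` \<Lambda>. \<exists>m\<in>\<Lambda>. p = r + 2 *\<^sub>R m"
      using rep by (fastforce simp: cls_def)
    show "\<forall>r\<in>rep ` \<Lambda>. \<forall>r'\<in>rep ` \<Lambda>. \<forall>m\<in>\<Lambda>. r = r' + 2 *\<^sub>R m \<longrightarrow> r = r'"
    proof (intro ballI impI)
      fix r r' m
      assume that: "r \<in> rep ` \<Lambda>" "r' \<in> rep ` \<Lambda>" "m \<in> \<Lambda>" "r = r' + 2 *\<^sub>R m"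
      obtain p p' where p: "p \<in> \<Lambda>" "r = rep p" "p' \<in> \<Lambda>" "r' = rep p'"
        using \<open>r \<in> rep ` \<Lambda>\<close> \<open>r' \<in> rep ` \<Lambda>\<close> by blast
      have "cls p = cls p'"
        using eq[OF that(4,3)] cls_rep p by simp
      then show "r = r'"
        by (simp add: p rep_def)
    qed
  qed
qed

text \<open>For lattice points \<open>p, q\<close> let \<open>r\<close> be the representative of the common class of \<open>p + q\<close> and \<open>p - q\<close>
  modulo \<open>2 \<Lambda>\<close>; then \<open>p = r + m + n\<close> and \<open>q = m - n\<close> with unique \<open>m, n\<close> in the lattice. In the new
  coordinates \<open>p + x\<close> and \<open>q + y\<close> are the sum and the difference of \<open>m + (r + x + y) / 2\<close> and
  \<open>n + (r + x - y) / 2\<close>, so the parallelogram law splits the double sum into products over the classes.\<close>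

lemma theta_mult_has_sum:
  assumes L: "is_lattice \<Lambda>" and "a > 0"
    and R: "R \<subseteq> \<Lambda>"
      "\<forall>p\<in>\<Lambda>. \<exists>r\<in>R. \<exists>m\<in>\<Lambda>. p = r + 2 *\<^sub>R m"
      "\<forall>r\<in>R. \<forall>r'\<in>R. \<forall>m\<in>\<Lambda>. r = r' + 2 *\<^sub>R m \<longrightarrow> r = r'"
  shows "((\<lambda>r. theta \<Lambda> (2 * a) ((1 / 2) *\<^sub>R (r + x + y)) * theta \<Lambda> (2 * a) ((1 / 2) *\<^sub>R (r + x - y)))
    has_sum (theta \<Lambda> a x * theta \<Lambda> a y)) R"
proof -
  let ?e = "\<lambda>a v p. exp (- (a * (norm (p + v))\<^sup>2))"
  define \<psi> where "\<psi> = (\<lambda>(r, m, n). (r + m + n, m - n) :: 'a \<times> 'a)"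
  have bij: "bij_betw \<psi> (R \<times> \<Lambda> \<times> \<Lambda>) (\<Lambda> \<times> \<Lambda>)"
  proof (rule bij_betwI')
    fix u w assume uw: "u \<in> R \<times> \<Lambda> \<times> \<Lambda>" "w \<in> R \<times> \<Lambda> \<times> \<Lambda>"
    obtain r m n r' m' n' where [simp]: "u = (r, m, n)" "w = (r', m', n')"
      by (cases u, cases w) auto
    show "(\<psi> u = \<psi> w) = (u = w)"
    proof
      assume "\<psi> u = \<psi> w"
      then have 1: "r + m + n = r' + m' + n'" and 2: "m - n = m' - n'"
        by (auto simp: \<psi>_def)
      have "(r + m + n) + (m - n) = (r' + m' + n') + (m' - n')"
        using 1 2 by simp
      then have 3: "r = r' + 2 *\<^sub>R (m' - m)"
        by (simp add: scaleR_2 algebra_simps)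
      moreover have "r \<in> R" "r' \<in> R" "m' - m \<in> \<Lambda>"
        using uw lattice_diff[OF L] by auto
      ultimately have r: "r = r'"
        using R(3) by blast
      then have "m = m'"
        using 3 by simp
      then show "u = w"
        using r 2 by simp
    qed simp
  next
    fix u assume "u \<in> R \<times> \<Lambda> \<times> \<Lambda>"
    then show "\<psi> u \<in> \<Lambda> \<times> \<Lambda>"
      using R(1) by (auto simp: \<psi>_def intro!: lattice_add[OF L] lattice_diff[OF L])
  next
    fix w assume w: "w \<in> \<Lambda> \<times> \<Lambda>"
    obtain p q where [simp]: "w = (p, q)"
      by (cases w)
    have pq: "p \<in> \<Lambda>" "q \<in> \<Lambda>"
      using w by auto
    obtain r m where rm: "r \<in> R" "m \<in> \<Lambda>" "p + q = r + 2 *\<^sub>R m"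
      using R(2) lattice_add[OF L pq] by blast
    have "p = r + m + (m - q)"
      using rm(3) by (simp add: scaleR_2 algebra_simps)
    then have "w = \<psi> (r, m, m - q)"
      by (simp add: \<psi>_def)
    then show "\<exists>u\<in>R \<times> \<Lambda> \<times> \<Lambda>. w = \<psi> u"
      using rm pq lattice_diff[OF L, of m q] by blast
  qed
  have "((\<lambda>(p, q). ?e a x p * ?e a y q) has_sum (theta \<Lambda> a x * theta \<Lambda> a y)) (\<Lambda> \<times> \<Lambda>)"
    using assms by (intro has_sum_Times_mult theta_has_sum) auto
  then have "((\<lambda>z. case \<psi> z of (p, q) \<Rightarrow> ?e a x p * ?e a y q) has_sum (theta \<Lambda> a x * theta \<Lambda> a y))
      (R \<times> \<Lambda> \<times> \<Lambda>)"
    by (subst has_sum_reindex_bij_betw[OF bij])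
  then show ?thesis
  proof (rule has_sum_SigmaD)
    fix r
    let ?u = "(1 / 2) *\<^sub>R (r + x + y)" and ?w = "(1 / 2) *\<^sub>R (r + x - y)"
    have "?e a x (r + m + n) * ?e a y (m - n) = ?e (2 * a) ?u m * ?e (2 * a) ?w n" for m n
    proof -
      have par: "(norm (P + Q))\<^sup>2 + (norm (P - Q))\<^sup>2 = 2 * (norm P)\<^sup>2 + 2 * (norm Q)\<^sup>2" for P Q :: 'a
        by (simp add: power2_norm_eq_inner inner_add inner_diff inner_commute)
      have eq: "r + m + n + x = (m + ?u) + (n + ?w)" "m - n + y = (m + ?u) - (n + ?w)"
        by (simp_all add: algebra_simps flip: scaleR_add_left)
      have "a * (norm (r + m + n + x))\<^sup>2 + a * (norm (m - n + y))\<^sup>2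
          = a * ((norm ((m + ?u) + (n + ?w)))\<^sup>2 + (norm ((m + ?u) - (n + ?w)))\<^sup>2)"
        unfolding eq by (simp add: distrib_left)
      also have "\<dots> = 2 * a * (norm (m + ?u))\<^sup>2 + 2 * a * (norm (n + ?w))\<^sup>2"
        unfolding par by (simp add: distrib_left)
      finally show ?thesis
        by (simp add: exp_add[symmetric])
    qed
    then have "(\<lambda>z. case \<psi> (r, z) of (p, q) \<Rightarrow> ?e a x p * ?e a y q)
        = (\<lambda>(m, n). ?e (2 * a) ?u m * ?e (2 * a) ?w n)"
      by (auto simp: \<psi>_def)
    moreover have "((\<lambda>(m, n). ?e (2 * a) ?u m * ?e (2 * a) ?w n)
        has_sum (theta \<Lambda> (2 * a) ?u * theta \<Lambda> (2 * a) ?w)) (\<Lambda> \<times> \<Lambda>)"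
      using assms by (intro has_sum_Times_mult theta_has_sum) auto
    ultimately show "((\<lambda>z. case \<psi> (r, z) of (p, q) \<Rightarrow> ?e a x p * ?e a y q)
        has_sum (theta \<Lambda> (2 * a) ?u * theta \<Lambda> (2 * a) ?w)) (\<Lambda> \<times> \<Lambda>)"
      by (simp only:)
  qed
qed

text \<open>With \<open>f r = \<theta>(2 a, r / 2 + v)\<close> and \<open>g r = \<theta>(2 a, r / 2)\<close>, three instances of the product formula
  express \<open>\<theta>(0)\<^sup>2\<close>, \<open>\<theta>(2 v) \<theta>(0)\<close> and \<open>\<theta>(v)\<^sup>2\<close> as the sums of \<open>g\<^sup>2\<close>, \<open>f\<^sup>2\<close> and \<open>f g\<close>. The defect in the inequality
  is therefore the sum of the squares \<open>(f r - g r)\<^sup>2\<close>; if it vanishes, the trivial class gives the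
  equality for \<open>2 a\<close>.\<close>

lemma theta_doubling:
  assumes L: "is_lattice \<Lambda>" and a: "a > 0"
  shows "2 * (theta \<Lambda> a v)\<^sup>2 \<le> (theta \<Lambda> a 0)\<^sup>2 + theta \<Lambda> a 0 * theta \<Lambda> a (2 *\<^sub>R v)" (is ?le)
    and "2 * (theta \<Lambda> a v)\<^sup>2 = (theta \<Lambda> a 0)\<^sup>2 + theta \<Lambda> a 0 * theta \<Lambda> a (2 *\<^sub>R v)
      \<Longrightarrow> theta \<Lambda> (2 * a) v = theta \<Lambda> (2 * a) 0"
proof -
  obtain R where R: "R \<subseteq> \<Lambda>"
      "\<forall>p\<in>\<Lambda>. \<exists>r\<in>R. \<exists>m\<in>\<Lambda>. p = r + 2 *\<^sub>R m"
      "\<forall>r\<in>R. \<forall>r'\<in>R. \<forall>m\<in>\<Lambda>. r = r' + 2 *\<^sub>R m \<longrightarrow> r = r'"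
    using lattice_half_transversal[OF L] by blast
  note mult = theta_mult_has_sum[OF L a R]
  let ?f = "\<lambda>r. theta \<Lambda> (2 * a) ((1 / 2) *\<^sub>R r + v)" and ?g = "\<lambda>r. theta \<Lambda> (2 * a) ((1 / 2) *\<^sub>R r)"
  let ?S = "(theta \<Lambda> a 0)\<^sup>2 + theta \<Lambda> a 0 * theta \<Lambda> a (2 *\<^sub>R v) - 2 * (theta \<Lambda> a v)\<^sup>2"
  have half: "(1 / 2) *\<^sub>R (r + v + v) = (1 / 2) *\<^sub>R r + v"
    "(1 / 2) *\<^sub>R (r + 2 *\<^sub>R v) = (1 / 2) *\<^sub>R r + v" for r
    by (simp_all add: scaleR_add_right flip: scaleR_add_left)
  have "((\<lambda>r. ?g r * ?g r) has_sum (theta \<Lambda> a 0 * theta \<Lambda> a 0)) R"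
    using mult[where x = 0 and y = 0] by simp
  moreover have "((\<lambda>r. ?f r * ?f r) has_sum (theta \<Lambda> a (2 *\<^sub>R v) * theta \<Lambda> a 0)) R"
    using mult[where x = "2 *\<^sub>R v" and y = 0] by (simp add: half)
  moreover have "((\<lambda>r. 2 * (?f r * ?g r)) has_sum (2 * (theta \<Lambda> a v * theta \<Lambda> a v))) R"
    using mult[where x = v and y = v] by (intro has_sum_cmult_right) (simp add: half)
  ultimately have "((\<lambda>r. ?g r * ?g r + ?f r * ?f r + - (2 * (?f r * ?g r))) has_sum
      (theta \<Lambda> a 0 * theta \<Lambda> a 0 + theta \<Lambda> a (2 *\<^sub>R v) * theta \<Lambda> a 0
        + - (2 * (theta \<Lambda> a v * theta \<Lambda> a v)))) R"
    by (intro has_sum_add has_sum_uminusI)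
  then have sq: "((\<lambda>r. (?f r - ?g r)\<^sup>2) has_sum ?S) R"
    by (simp add: power2_eq_square algebra_simps)
  show ?le
    using has_sum_nonneg[OF sq] by simp
  assume "2 * (theta \<Lambda> a v)\<^sup>2 = (theta \<Lambda> a 0)\<^sup>2 + theta \<Lambda> a 0 * theta \<Lambda> a (2 *\<^sub>R v)"
  then have S: "?S \<le> 0"
    by simp
  \<comment> \<open>the representative of the class \<open>2 \<Lambda>\<close>\<close>
  obtain r m where r: "r \<in> R" "m \<in> \<Lambda>" "0 = r + 2 *\<^sub>R m"
    using R(2) lattice_0[OF L] by blast
  then have "r = 2 *\<^sub>R (- m)"
    by (simp add: eq_neg_iff_add_eq_0)
  then have r_half: "(1 / 2) *\<^sub>R r = - m"
    by simp
  have m: "- m \<in> \<Lambda>"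
    using lattice_diff[OF L lattice_0[OF L] r(2)] by simp
  have "(?f r - ?g r)\<^sup>2 = 0"
    by (rule nonneg_has_sum_le_0D[OF sq S _ r(1)]) simp
  then have "theta \<Lambda> (2 * a) (- m + v) = theta \<Lambda> (2 * a) (- m + 0)"
    by (simp add: r_half)
  then show "theta \<Lambda> (2 * a) v = theta \<Lambda> (2 * a) 0"
    by (simp only: theta_periodic[OF L m])
qed

text \<open>Take suprema in \<open>2 \<theta>(v)\<^sup>2 \<le> \<theta>(0)\<^sup>2 + \<theta>(0) \<theta>(2 v)\<close>: the finite supremum \<open>M\<close> satisfies
  \<open>2 M\<^sup>2 \<le> C\<^sup>2 + C M\<close> with \<open>C = \<theta>(0)\<close>, that is \<open>(M - C) (2 M + C) \<le> 0\<close>.\<close>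

lemma theta_le_theta_0:
  assumes L: "is_lattice \<Lambda>" and a: "a > 0"
  shows "theta \<Lambda> a v \<le> theta \<Lambda> a 0"
proof -
  define M where "M = (SUP v. theta \<Lambda> a v)"
  let ?C = "theta \<Lambda> a 0"
  obtain B where "\<And>v. theta \<Lambda> a v \<le> B"
    using theta_bounded[OF assms] by blast
  then have bdd: "bdd_above (range (theta \<Lambda> a))"
    by (auto simp: bdd_above_def)
  have le: "theta \<Lambda> a v \<le> M" for v
    unfolding M_def using bdd by (simp add: cSUP_upper)
  have C: "?C \<ge> 1"
    by (rule theta_0_ge_1[OF assms])
  have "M \<le> sqrt ((?C\<^sup>2 + ?C * M) / 2)"
    unfolding M_def
  proof (rule cSUP_least)
    fix v
    have "(theta \<Lambda> a v)\<^sup>2 \<le> (?C\<^sup>2 + ?C * theta \<Lambda> a (2 *\<^sub>R v)) / 2"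
      using theta_doubling(1)[OF assms, of v] by simp
    also have "\<dots> \<le> (?C\<^sup>2 + ?C * M) / 2"
      using C le by (intro divide_right_mono add_left_mono mult_left_mono) auto
    finally show "theta \<Lambda> a v \<le> sqrt ((?C\<^sup>2 + ?C * (SUP v. theta \<Lambda> a v)) / 2)"
      by (simp add: M_def real_le_rsqrt)
  qed simp
  moreover have M: "M \<ge> 1"
    using le[of 0] C by simp
  ultimately have "M\<^sup>2 \<le> (?C\<^sup>2 + ?C * M) / 2"
    using C by (metis le_divide_eq real_sqrt_le_iff real_sqrt_abs2 power2_eq_square abs_of_nonneg
        order_trans zero_le_one)
  then have "(M - ?C) * (2 * M + ?C) \<le> 0"
    by (simp add: algebra_simps power2_eq_square)
  then have "M \<le> ?C"
    using M C by (auto simp: mult_le_0_iff)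
  then show ?thesis
    using le[of v] by simp
qed

lemma theta_eq_theta_0_double:
  assumes L: "is_lattice \<Lambda>" and a: "a > 0" and eq: "theta \<Lambda> a v = theta \<Lambda> a 0"
  shows "theta \<Lambda> (2 * a) v = theta \<Lambda> (2 * a) 0"
proof (rule theta_doubling(2)[OF L a])
  let ?C = "theta \<Lambda> a 0"
  have "?C * theta \<Lambda> a (2 *\<^sub>R v) \<le> ?C * ?C"
    by (intro mult_left_mono theta_le_theta_0[OF L a] theta_nonneg)
  then show "2 * (theta \<Lambda> a v)\<^sup>2 = ?C\<^sup>2 + ?C * theta \<Lambda> a (2 *\<^sub>R v)"
    using theta_doubling(1)[OF L a, of v] eq by (simp add: power2_eq_square)
qed

text \<open>Equality passes from \<open>a\<close> to \<open>2 a\<close>, hence to every \<open>2\<^sup>k a\<close>. If \<open>v\<close> were no lattice point, all terms of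
  the sum would lie below 1 and the sum at \<open>2\<^sup>k a\<close>, whose terms are the \<open>2\<^sup>k\<close>-th powers, would tend to 0;
  but at the origin the theta function is at least 1.\<close>

lemma theta_eq_theta_0_imp_lattice:
  assumes L: "is_lattice \<Lambda>" and a: "a > 0" and eq: "theta \<Lambda> a v = theta \<Lambda> a 0"
  shows "v \<in> \<Lambda>"
proof (rule ccontr)
  assume notin: "v \<notin> \<Lambda>"
  let ?e = "\<lambda>p. exp (- (a * (norm (p + v))\<^sup>2))"
  have eq_k: "theta \<Lambda> (2 ^ k * a) v = theta \<Lambda> (2 ^ k * a) 0" for k :: nat
  proof (induction k)
    case (Suc k)
    then show ?case
      using theta_eq_theta_0_double[OF L, of "2 ^ k * a" v] a by (simp add: mult.assoc)
  qed (simp add: eq)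
  have e: "0 \<le> ?e p" "?e p \<le> 1" for p
    using a by auto
  have less: "?e p < 1" if "p \<in> \<Lambda>" for p
  proof -
    have "p + v \<noteq> 0"
      using notin lattice_diff[OF L lattice_0[OF L] that] by (auto simp: add_eq_0_iff)
    then show ?thesis
      using a by simp
  qed
  have summ: "?e summable_on \<Lambda>"
    by (rule gaussian_summable[OF L a])
  obtain F where F: "finite F" "F \<subseteq> \<Lambda>" "dist (sum ?e F) (infsum ?e \<Lambda>) \<le> 1 / 4"
    using infsum_finite_approximation[OF summ, of "1 / 4"] by auto
  have "infsum ?e \<Lambda> - sum ?e F \<le> 1 / 4"
    using F(3) unfolding dist_real_def by linarith
  then have tail: "infsum ?e (\<Lambda> - F) \<le> 1 / 4"
    using infsum_Diff[OF summ, of F] F by simp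
  have "((\<lambda>k. \<Sum>p\<in>F. ?e p ^ (2 ^ k)) \<longlongrightarrow> (\<Sum>p\<in>F. 0)) sequentially"
  proof (rule tendsto_sum)
    fix p assume "p \<in> F"
    have "(\<lambda>n. ?e p ^ n) \<longlonglongrightarrow> 0"
      using less[of p] \<open>p \<in> F\<close> F(2) by (intro LIMSEQ_realpow_zero) auto
    moreover have "filterlim (\<lambda>k::nat. 2 ^ k :: nat) sequentially sequentially"
      by (rule filterlim_subseq) (simp add: strict_mono_def)
    ultimately show "((\<lambda>k. ?e p ^ (2 ^ k)) \<longlongrightarrow> 0) sequentially"
      by (rule filterlim_compose)
  qed
  then have "eventually (\<lambda>k. (\<Sum>p\<in>F. ?e p ^ (2 ^ k)) < 1 / 4) sequentially"
    by (rule order_tendstoD(2)) simp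
  then obtain k :: nat where k: "(\<Sum>p\<in>F. ?e p ^ (2 ^ k)) < 1 / 4"
    by (auto simp: eventually_sequentially)
  let ?E = "\<lambda>p. exp (- (2 ^ k * a * (norm (p + v))\<^sup>2))"
  have E: "?E p = ?e p ^ (2 ^ k)" for p
    by (simp add: exp_of_nat_mult[symmetric] mult.assoc)
  have summE: "?E summable_on \<Lambda>"
    using a by (intro gaussian_summable[OF L]) simp
  have "infsum ?E (\<Lambda> - F) \<le> infsum ?e (\<Lambda> - F)"
  proof (rule infsum_mono)
    show "?E p \<le> ?e p" for p
      unfolding E using power_decreasing[OF _ e, of 1 "2 ^ k" p] by simp
  qed (use summ summE F in \<open>auto intro: summable_on_subset\<close>)
  then have "theta \<Lambda> (2 ^ k * a) v \<le> 1 / 4 + (\<Sum>p\<in>F. ?e p ^ (2 ^ k))"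
    using tail infsum_Diff[OF summE, of F] F by (simp add: theta_def E)
  then show False
    using k eq_k[of k] theta_0_ge_1[OF L, of "2 ^ k * a"] a by simp
qed

section \<open>The Gaussian as a superposition of tents\<close>

text \<open>The second difference at \<open>L\<close> of the sequence \<open>n \<mapsto> exp (- a n\<^sup>2)\<close>. It is cut off below 2 because
  at \<open>L = 1\<close> it involves the top of the Gaussian, where the sequence may be concave.\<close>

definition second_diff :: "real \<Rightarrow> nat \<Rightarrow> real" where
  "second_diff a L = (if L \<ge> 2
     then exp (- (a * (real (L - 1))\<^sup>2)) - 2 * exp (- (a * (real L)\<^sup>2)) + exp (- (a * (real (L + 1))\<^sup>2))
     else 0)"

text \<open>Already \<open>exp (- a (L - 1)\<^sup>2)\<close> exceeds \<open>2 exp (- a L\<^sup>2)\<close>: the quotient is \<open>exp (a (2 L - 1))\<close>, and the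
  exponent is at least \<open>3 / 2\<close>.\<close>

lemma second_diff_pos:
  assumes "a \<ge> 1 / 2" "L \<ge> 2"
  shows "second_diff a L > 0"
proof -
  obtain k where L: "L = k + 2"
    using assms(2) by (metis add.commute le_Suc_ex)
  have "3 / 2 \<le> a * (2 * real k + 3)"
    using assms(1) mult_mono[of "1 / 2" a 3 "2 * real k + 3"] by simp
  then have "2 < exp (a * (2 * real k + 3))"
    using exp_ge_add_one_self[of "a * (2 * real k + 3)"] by linarith
  then have "2 * exp (- (a * (real L)\<^sup>2)) < exp (a * (2 * real k + 3)) * exp (- (a * (real L)\<^sup>2))"
    by simp
  also have "\<dots> = exp (- (a * (real (L - 1))\<^sup>2))"
    by (simp add: L exp_add[symmetric] algebra_simps power2_eq_square)
  finally show ?thesis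
    using assms(2) by (simp add: second_diff_def add_pos_pos)
qed

lemma second_diff_nonneg: "a \<ge> 1 / 2 \<Longrightarrow> second_diff a L \<ge> 0"
  using second_diff_pos[of a L] by (cases "L \<ge> 2") (auto simp: second_diff_def)

lemma linear_times_gaussian_tendsto_0:
  fixes a :: real
  assumes "a > 0"
  shows "(\<lambda>n. real n * exp (- (a * (real n)\<^sup>2))) \<longlonglongrightarrow> 0"
proof (rule real_tendsto_sandwich[of "\<lambda>_. 0" _ _ "\<lambda>n. inverse a * inverse (real n)"])
  have "real n * exp (- (a * (real n)\<^sup>2)) \<le> inverse a * inverse (real n)" if "n \<ge> 1" for n
  proof -
    have pos: "0 < a * (real n)\<^sup>2"
      using assms that by simp
    have "a * (real n)\<^sup>2 \<le> exp (a * (real n)\<^sup>2)"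
      using exp_ge_add_one_self[of "a * (real n)\<^sup>2"] by linarith
    then have "exp (- (a * (real n)\<^sup>2)) \<le> inverse (a * (real n)\<^sup>2)"
      unfolding exp_minus using pos by (rule le_imp_inverse_le)
    then have "real n * exp (- (a * (real n)\<^sup>2)) \<le> real n * inverse (a * (real n)\<^sup>2)"
      by (intro mult_left_mono) auto
    also have "\<dots> = inverse a * inverse (real n)"
      using assms that by (simp add: field_simps power2_eq_square)
    finally show ?thesis .
  qed
  then show "eventually (\<lambda>n. real n * exp (- (a * (real n)\<^sup>2)) \<le> inverse a * inverse (real n)) sequentially"
    by (auto simp: eventually_sequentially)
  show "(\<lambda>n. inverse a * inverse (real n)) \<longlonglongrightarrow> 0"
    using tendsto_mult_left[OF lim_inverse_n, of "inverse a"] by simp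
qed auto

text \<open>Twofold summation by parts. The truncated subtraction makes \<open>L - m\<close> the tent \<open>max (L - m) 0\<close>.
  The condition \<open>m \<ge> 1\<close> ensures that only second differences at \<open>L \<ge> 2\<close> occur.\<close>

lemma gaussian_eq_sum_of_tents:
  assumes a: "a \<ge> 1 / 2" and m: "m \<ge> 1"
  shows "((\<lambda>L. second_diff a L * real (L - m)) has_sum exp (- (a * (real m)\<^sup>2))) UNIV"
proof (rule sums_nonneg_imp_has_sum)
  let ?w = "\<lambda>n. exp (- (a * (real n)\<^sup>2))"
  let ?v = "\<lambda>n. real n * ?w n"
  have partial: "(\<Sum>L<m + 1 + j. second_diff a L * real (L - m))
      = ?w m - (real j + 1) * ?w (m + j) + real j * ?w (m + j + 1)" for j
  proof (induction j)
    case (Suc j)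
    have "second_diff a (m + 1 + j) = ?w (m + j) - 2 * ?w (m + j + 1) + ?w (m + j + 2)"
      using m by (simp add: second_diff_def)
    moreover have "real (m + 1 + j - m) = real j + 1"
      by simp
    moreover have "(\<Sum>L<m + 1 + Suc j. second_diff a L * real (L - m))
        = (\<Sum>L<m + 1 + j. second_diff a L * real (L - m))
          + second_diff a (m + 1 + j) * real (m + 1 + j - m)"
      by simp
    ultimately have "(\<Sum>L<m + 1 + Suc j. second_diff a L * real (L - m))
        = ?w m - (real j + 1) * ?w (m + j) + real j * ?w (m + j + 1)
          + (?w (m + j) - 2 * ?w (m + j + 1) + ?w (m + j + 2)) * (real j + 1)"
      using Suc by simp
    also have "\<dots> = ?w m - (real (Suc j) + 1) * ?w (m + Suc j) + real (Suc j) * ?w (m + Suc j + 1)"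
      by (simp add: algebra_simps)
    finally show ?case .
  qed simp
  have v: "(\<lambda>j. ?v (j + k)) \<longlonglongrightarrow> 0" for k
    using a by (intro LIMSEQ_ignore_initial_segment linear_times_gaussian_tendsto_0) simp
  have "(\<lambda>j. (real j + 1) * ?w (m + j)) \<longlonglongrightarrow> 0"
    by (rule real_tendsto_sandwich[OF _ _ tendsto_const v[of m]])
      (use m in \<open>auto simp: add.commute\<close>)
  moreover have "(\<lambda>j. real j * ?w (m + j + 1)) \<longlonglongrightarrow> 0"
    by (rule real_tendsto_sandwich[OF _ _ tendsto_const v[of "m + 1"]])
      (auto simp: add.commute add.left_commute)
  ultimately have "(\<lambda>j. ?w m - (real j + 1) * ?w (m + j) + real j * ?w (m + j + 1))
      \<longlonglongrightarrow> ?w m - 0 + 0"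
    by (intro tendsto_intros)
  then have "(\<lambda>j. \<Sum>L<j + (m + 1). second_diff a L * real (L - m)) \<longlonglongrightarrow> ?w m"
    unfolding partial[symmetric] by (simp add: add.commute add.left_commute)
  then show "(\<lambda>L. second_diff a L * real (L - m)) sums ?w m"
    unfolding sums_def by (rule LIMSEQ_offset)
qed (use second_diff_nonneg[OF a] in simp)

text \<open>Compare with \<open>m = 1\<close> above, using \<open>L \<le> 2 (L - 1)\<close> for \<open>L \<ge> 2\<close>.\<close>

lemma second_diff_moment_summable:
  assumes a: "a \<ge> 1 / 2"
  shows "(\<lambda>L. second_diff a L * real L) summable_on UNIV"
proof (rule summable_on_comparison_test)
  show "(\<lambda>L. 2 * (second_diff a L * real (L - 1))) summable_on UNIV"
    using gaussian_eq_sum_of_tents[OF a, of 1]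
    by (intro summable_on_cmult_right) (auto simp: has_sum_imp_summable)
  show "second_diff a L * real L \<le> 2 * (second_diff a L * real (L - 1))" for L
  proof (cases "L \<ge> 2")
    case True
    then have "second_diff a L * real L \<le> second_diff a L * (2 * real (L - 1))"
      by (intro mult_left_mono second_diff_nonneg[OF a]) auto
    then show ?thesis
      by simp
  qed (simp add: second_diff_def)
qed (use second_diff_nonneg[OF a] in simp)

text \<open>At \<open>i = 0\<close> the superposition of tents differs from the Gaussian by this amount.\<close>

definition diag_excess :: "real \<Rightarrow> real" where
  "diag_excess a = (\<Sum>\<^sub>\<infinity>L. second_diff a L * real L) - 1"

text \<open>Replace the Gaussian weight by its superposition of tents and interchange the sums. The term
  \<open>i = 0\<close> is wrong by \<open>diag_excess a\<close>.\<close>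

lemma gaussian_sum_eq_tent_sums:
  fixes u :: "int \<Rightarrow> real"
  assumes a: "a \<ge> 1 / 2" and u: "\<And>i. 0 \<le> u i" "\<And>i. u i \<le> 1"
  shows "((\<lambda>L. second_diff a L * (\<Sum>i\<in>{- int L<..<int L}. real (L - nat \<bar>i\<bar>) * u i)) has_sum
      ((\<Sum>\<^sub>\<infinity>i. exp (- (a * (of_int i)\<^sup>2)) * u i) + diag_excess a * u 0)) UNIV"
proof -
  let ?W = "\<lambda>i::int. exp (- (a * (of_int i)\<^sup>2))"
  let ?K = "\<Sum>\<^sub>\<infinity>L. second_diff a L * real L"
  define g where "g i = ?W i * u i + (if i = 0 then diag_excess a * u i else 0)" for i
  let ?f = "\<lambda>i L. second_diff a L * real (L - nat \<bar>i\<bar>) * u i"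
  let ?S = "(\<Sum>\<^sub>\<infinity>i. ?W i * u i) + diag_excess a * u 0"
  have Wu: "(\<lambda>i. ?W i * u i) summable_on UNIV"
  proof (rule summable_on_comparison_test)
    show "?W summable_on UNIV"
      using a by (intro gaussian_summable_int) simp
  qed (auto simp: u mult_left_le)
  have "((\<lambda>i. if i = 0 then diag_excess a * u i else 0) has_sum (diag_excess a * u 0)) UNIV"
    by (rule has_sum_finite_neutralI[of "{0}"]) auto
  then have g: "(g has_sum ?S) UNIV"
    unfolding g_def using Wu by (intro has_sum_add) auto
  have f: "(?f i has_sum g i) UNIV" for i
  proof (cases "i = 0")
    case True
    have "g 0 = ?K * u 0"
      by (simp add: g_def diag_excess_def algebra_simps)
    then show ?thesis
      using True second_diff_moment_summable[OF a] by (auto intro!: has_sum_cmult_left)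
  next
    case False
    then have "nat \<bar>i\<bar> \<ge> 1"
      by linarith
    from gaussian_eq_sum_of_tents[OF a this]
    have "((\<lambda>L. second_diff a L * real (L - nat \<bar>i\<bar>)) has_sum ?W i) UNIV"
      by simp
    then show ?thesis
      using False has_sum_cmult_left by (fastforce simp: g_def)
  qed
  have fsum: "(\<lambda>(i, L). ?f i L) summable_on (UNIV \<times> UNIV)"
    by (rule summable_on_SigmaI[where g = g])
      (use f g u second_diff_nonneg[OF a] in \<open>auto simp: has_sum_imp_summable\<close>)
  have "((\<lambda>(i, L). ?f i L) has_sum ?S) (UNIV \<times> UNIV)"
    by (rule has_sum_SigmaI[OF _ g fsum]) (use f in simp)
  then have swap: "((\<lambda>(L, i). ?f i L) has_sum ?S) (UNIV \<times> UNIV)"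
    by (subst (asm) has_sum_swap) (simp add: case_prod_unfold)
  show ?thesis
  proof (rule has_sum_SigmaD[OF swap])
    fix L :: nat
    show "((\<lambda>i. case (L, i) of (L, i) \<Rightarrow> ?f i L) has_sum
        second_diff a L * (\<Sum>i\<in>{- int L<..<int L}. real (L - nat \<bar>i\<bar>) * u i)) UNIV"
      by (rule has_sum_finite_neutralI[of "{- int L<..<int L}"])
        (auto simp: sum_distrib_left mult.assoc)
  qed
qed

lemma sum_shift_period:
  fixes g :: "int \<Rightarrow> real"
  assumes "\<And>h. g (h + int N) = g h"
  shows "(\<Sum>h=1..int N. g (h + int x)) = (\<Sum>h=1..int N. g h)"
proof (induction x)
  case (Suc x)
  have "(\<Sum>h=1..int N. g (h + int (Suc x))) = (\<Sum>h\<in>{2..int N + 1}. g (h + int x))"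
    by (rule sum.reindex_bij_witness[of _ "\<lambda>h. h - 1" "\<lambda>h. h + 1"]) (auto simp: algebra_simps)
  also have "\<dots> = (\<Sum>h=1..int N. g (h + int x))"
  proof (cases "N = 0")
    case False
    then have 1: "{1..int N} = insert 1 {2..int N}" and 2: "{2..int N + 1} = insert (int N + 1) {2..int N}"
      by auto
    have "g (int N + 1 + int x) = g (1 + int x)"
      using assms[of "1 + int x"] by (simp add: algebra_simps)
    then show ?thesis
      unfolding 1 2 by simp
  qed simp
  finally show ?case
    using Suc by simp
qed simp

text \<open>Exactly \<open>L - |i|\<close> pairs in a window of length \<open>L\<close> have difference \<open>i\<close>.\<close>

lemma sum_differences_eq_tent:
  fixes f :: "int \<Rightarrow> real"
  shows "(\<Sum>x<L. \<Sum>y<L. f (int y - int x)) = (\<Sum>i\<in>{- int L<..<int L}. real (L - nat \<bar>i\<bar>) * f i)"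
proof -
  let ?d = "\<lambda>(x, y). int y - int x"
  have card: "card {z \<in> {..<L} \<times> {..<L}. ?d z = i} = L - nat \<bar>i\<bar>" for i
  proof -
    have "bij_betw (\<lambda>k. (k + nat (- i), k + nat i)) {..<L - nat \<bar>i\<bar>} {z \<in> {..<L} \<times> {..<L}. ?d z = i}"
      by (rule bij_betwI[where g = "\<lambda>(x, y). min x y"]) (auto simp: min_def)
    then show ?thesis
      using bij_betw_same_card by fastforce
  qed
  have "(\<Sum>x<L. \<Sum>y<L. f (int y - int x)) = (\<Sum>z\<in>{..<L} \<times> {..<L}. f (?d z))"
    by (simp add: sum.cartesian_product case_prod_unfold)
  also have "\<dots> = (\<Sum>i\<in>{- int L<..<int L}. \<Sum>z\<in>{z \<in> {..<L} \<times> {..<L}. ?d z = i}. f (?d z))"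
    by (rule sum.group[symmetric]) auto
  also have "\<dots> = (\<Sum>i\<in>{- int L<..<int L}. \<Sum>z\<in>{z \<in> {..<L} \<times> {..<L}. ?d z = i}. f i)"
    by (intro sum.cong) auto
  also have "\<dots> = (\<Sum>i\<in>{- int L<..<int L}. real (L - nat \<bar>i\<bar>) * f i)"
    by (simp add: card)
  finally show ?thesis .
qed

section \<open>Coincidence energy and windows\<close>

text \<open>The one-dimensional energy to which the problem reduces: layers interact only if they carry the
  same shift.\<close>

definition coincidence_energy :: "real \<Rightarrow> (int \<Rightarrow> 'a) \<Rightarrow> nat \<Rightarrow> real" where
  "coincidence_energy a s N =
     (\<Sum>h=1..int N. \<Sum>\<^sub>\<infinity>i. exp (- (a * (of_int i)\<^sup>2)) * of_bool (s h = s (h + i)))"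

text \<open>The values of \<open>s\<close> are thought of as colours. Counting ordered pairs, with the diagonal, makes the
  number of pairs the sum of the squares of the multiplicities of the colours in the window.\<close>

definition window_pairs :: "(int \<Rightarrow> 'a) \<Rightarrow> nat \<Rightarrow> int \<Rightarrow> int" where
  "window_pairs s L h = (\<Sum>x<L. \<Sum>y<L. of_bool (s (h + int x) = s (h + int y)))"

lemma window_pairs_total:
  assumes "has_period s N"
  shows "(\<Sum>h=1..int N. \<Sum>i\<in>{- int L<..<int L}. real (L - nat \<bar>i\<bar>) * of_bool (s h = s (h + i)))
    = (\<Sum>h=1..int N. real_of_int (window_pairs s L h))"
proof -
  have per: "s (i + int N) = s i" for i
    using assms by (simp add: has_period_def)
  have shift: "(\<Sum>h=1..int N. of_bool (s h = s (h + (int y - int x))))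
      = (\<Sum>h=1..int N. of_bool (s (h + int x) = s (h + int y)) :: real)" for x y
  proof -
    have "(\<Sum>h=1..int N. of_bool (s h = s (h + (int y - int x))) :: real)
        = (\<Sum>h=1..int N. of_bool (s (h + int x) = s ((h + int x) + (int y - int x))))"
      by (rule sum_shift_period[symmetric]) (metis (no_types) per add.assoc add.commute)
    then show ?thesis
      by (simp add: algebra_simps)
  qed
  have "(\<Sum>h=1..int N. \<Sum>i\<in>{- int L<..<int L}. real (L - nat \<bar>i\<bar>) * of_bool (s h = s (h + i)))
      = (\<Sum>h=1..int N. \<Sum>x<L. \<Sum>y<L. of_bool (s h = s (h + (int y - int x))))"
    by (simp only: sum_differences_eq_tent[where f = "\<lambda>i. of_bool (s _ = s (_ + i))"])
  also have "\<dots> = (\<Sum>x<L. \<Sum>y<L. \<Sum>h=1..int N. of_bool (s h = s (h + (int y - int x))))"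
    by (subst sum.swap) (intro sum.cong refl sum.swap)
  also have "\<dots> = (\<Sum>x<L. \<Sum>y<L. \<Sum>h=1..int N. of_bool (s (h + int x) = s (h + int y)))"
    by (simp only: shift)
  also have "\<dots> = (\<Sum>h=1..int N. \<Sum>x<L. \<Sum>y<L. of_bool (s (h + int x) = s (h + int y)))"
    by (subst (2) sum.swap) (intro sum.cong refl sum.swap)
  finally show ?thesis
    by (simp add: window_pairs_def)
qed

lemma has_sum_finite_sum:
  fixes f :: "'a \<Rightarrow> 'b \<Rightarrow> real"
  assumes "finite A" "\<And>a. a \<in> A \<Longrightarrow> (f a has_sum S a) B"
  shows "((\<lambda>b. \<Sum>a\<in>A. f a b) has_sum (\<Sum>a\<in>A. S a)) B"
  using assms by (induction A rule: finite_induct) (auto intro: has_sum_add)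

text \<open>Up to a constant, the coincidence energy is a superposition of window counts with coefficients
  that are positive from \<open>L = 2\<close> on. The windows of different lengths no longer interact, so each
  length can be optimised on its own.\<close>

lemma coincidence_energy_eq_windows:
  assumes a: "a \<ge> 1 / 2" and s: "has_period s N"
  shows "((\<lambda>L. second_diff a L * (\<Sum>h=1..int N. real_of_int (window_pairs s L h))) has_sum
    (coincidence_energy a s N + real N * diag_excess a)) UNIV"
proof -
  have "((\<lambda>L. \<Sum>h=1..int N. second_diff a L *
        (\<Sum>i\<in>{- int L<..<int L}. real (L - nat \<bar>i\<bar>) * of_bool (s h = s (h + i)))) has_sum
      (\<Sum>h=1..int N. (\<Sum>\<^sub>\<infinity>i. exp (- (a * (of_int i)\<^sup>2)) * of_bool (s h = s (h + i)))
         + diag_excess a * of_bool (s h = s (h + 0)))) UNIV"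
    by (intro has_sum_finite_sum gaussian_sum_eq_tent_sums[OF a]) auto
  then show ?thesis
    unfolding sum_distrib_left[symmetric] window_pairs_total[OF s] sum.distrib
      coincidence_energy_def[symmetric] by (simp add: mult.commute)
qed

section \<open>Balanced windows minimise\<close>

text \<open>With \<open>q = L div n\<close>, this is the sum of the squares of \<open>n\<close> integers of total \<open>L\<close>, each equal to \<open>q\<close> or
  \<open>q + 1\<close>; in this form it is the secant-line bound \<open>\<Sum> k\<^sup>2 \<ge> \<Sum> ((2 q + 1) k - q (q + 1))\<close>.\<close>

definition balanced_pairs :: "nat \<Rightarrow> nat \<Rightarrow> int" where
  "balanced_pairs n L = (2 * int (L div n) + 1) * int L - int n * int (L div n) * (int (L div n) + 1)"

definition window_count :: "(int \<Rightarrow> 'a) \<Rightarrow> nat \<Rightarrow> int \<Rightarrow> 'a \<Rightarrow> int" where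
  "window_count s L h c = (\<Sum>x<L. of_bool (s (h + int x) = c))"

text \<open>A window in which the colour \<open>c\<close> occurs \<open>k c\<close> times has \<open>\<Sum> (k c)\<^sup>2\<close> pairs, and
  \<open>k\<^sup>2 - (2 q + 1) k + q (q + 1) = (k - q) (k - q - 1)\<close>.\<close>

lemma window_pairs_defect:
  assumes H: "finite H" "range s \<subseteq> H"
  shows "window_pairs s L h - balanced_pairs (card H) L =
    (\<Sum>c\<in>H. (window_count s L h c - int (L div card H)) * (window_count s L h c - int (L div card H) - 1))"
proof -
  let ?k = "window_count s L h" and ?q = "int (L div card H)"
  have mem: "s i \<in> H" for i
    using H(2) by blast
  have "window_pairs s L h
      = (\<Sum>x<L. \<Sum>y<L. \<Sum>c\<in>H. of_bool (s (h + int x) = c) * of_bool (s (h + int y) = c))"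
    unfolding window_pairs_def
  proof (intro sum.cong refl)
    fix x y
    have "(\<Sum>c\<in>H. of_bool (s (h + int x) = c) * of_bool (s (h + int y) = c) :: int)
        = (\<Sum>c\<in>H. if c = s (h + int x) then of_bool (s (h + int x) = s (h + int y)) else 0)"
      by (intro sum.cong) auto
    then show "(of_bool (s (h + int x) = s (h + int y)) :: int)
        = (\<Sum>c\<in>H. of_bool (s (h + int x) = c) * of_bool (s (h + int y) = c))"
      using H(1) mem by simp
  qed
  also have "\<dots> = (\<Sum>x<L. \<Sum>c\<in>H. \<Sum>y<L. of_bool (s (h + int x) = c) * of_bool (s (h + int y) = c))"
    by (intro sum.cong refl sum.swap)
  also have "\<dots> = (\<Sum>c\<in>H. \<Sum>x<L. \<Sum>y<L. of_bool (s (h + int x) = c) * of_bool (s (h + int y) = c))"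
    by (rule sum.swap)
  also have "\<dots> = (\<Sum>c\<in>H. ?k c * ?k c)"
    by (simp only: window_count_def sum_product)
  finally have pairs: "window_pairs s L h = (\<Sum>c\<in>H. ?k c * ?k c)" .
  have "(\<Sum>c\<in>H. ?k c) = (\<Sum>x<L. \<Sum>c\<in>H. of_bool (s (h + int x) = c))"
    unfolding window_count_def by (rule sum.swap)
  also have "\<dots> = int L"
    using H(1) mem by (simp add: of_bool_def sum.delta')
  finally have total: "(\<Sum>c\<in>H. ?k c) = int L" .
  have "(\<Sum>c\<in>H. (?k c - ?q) * (?k c - ?q - 1))
      = (\<Sum>c\<in>H. ?k c * ?k c - (2 * ?q + 1) * ?k c + ?q * (?q + 1))"
    by (intro sum.cong) (auto simp: algebra_simps)
  also have "\<dots> = window_pairs s L h - balanced_pairs (card H) L"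
    unfolding sum.distrib sum_subtractf sum_distrib_left[symmetric] pairs[symmetric] total
    by (simp add: balanced_pairs_def algebra_simps)
  finally show ?thesis
    by simp
qed

lemma consecutive_product_nonneg: "0 \<le> x * (x - 1)" for x :: int
  by (cases "x \<le> 0") (auto intro: mult_nonpos_nonpos mult_nonneg_nonneg)

lemma window_pairs_ge:
  assumes H: "finite H" "range s \<subseteq> H"
  shows "window_pairs s L h \<ge> balanced_pairs (card H) L"
proof -
  have "0 \<le> window_pairs s L h - balanced_pairs (card H) L"
    unfolding window_pairs_defect[OF H] by (intro sum_nonneg consecutive_product_nonneg)
  then show ?thesis
    by simp
qed

lemma window_image:
  assumes H: "finite H" "range s \<subseteq> H"
    and inj: "inj_on s {h..<h + int (card H)}"
  shows "s ` {h..<h + int (card H)} = H"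
  by (rule card_subset_eq[OF H(1)]) (use H(2) card_image[OF inj] in auto)

lemma window_count_full:
  assumes H: "finite H" "range s \<subseteq> H"
    and inj: "inj_on s {h..<h + int (card H)}" and c: "c \<in> H"
  shows "window_count s (card H) h c = 1"
proof -
  have "c \<in> s ` {h..<h + int (card H)}"
    using c by (simp only: window_image[OF H inj])
  then obtain i where i: "i \<in> {h..<h + int (card H)}" "s i = c"
    by blast
  have "s (h + int x) = c \<longleftrightarrow> x = nat (i - h)" if "x < card H" for x
    using i that inj_onD[OF inj, of "h + int x" i] by auto
  then have "window_count s (card H) h c = (\<Sum>x<card H. if x = nat (i - h) then 1 else 0)"
    unfolding window_count_def by (intro sum.cong) auto
  moreover have "nat (i - h) < card H"
    using i by (simp add: nat_less_iff)
  ultimately show ?thesis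
    by simp
qed

text \<open>Lengthening the window by \<open>card H\<close> adds each colour once, so only windows shorter than that need a
  look.\<close>

lemma window_count_balanced:
  assumes H: "finite H" "range s \<subseteq> H" "H \<noteq> {}"
    and inj: "\<And>h. inj_on s {h..<h + int (card H)}" and c: "c \<in> H"
  shows "window_count s L h c \<in> {int (L div card H), int (L div card H) + 1}"
proof (induction L rule: less_induct)
  case (less L)
  let ?n = "card H"
  have n: "?n > 0"
    using H by (simp add: card_gt_0_iff)
  show ?case
  proof (cases "L < ?n")
    case True
    have "window_count s L h c \<le> window_count s ?n h c"
      unfolding window_count_def using True by (intro sum_mono2) auto
    moreover have "window_count s L h c \<ge> 0"
      unfolding window_count_def by (intro sum_nonneg) auto
    ultimately show ?thesis
      using True window_count_full[OF H(1,2) inj c, of h] by auto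
  next
    case False
    have "window_count s L h c = window_count s (L - ?n) h c + (\<Sum>x\<in>{L - ?n..<L}. of_bool (s (h + int x) = c))"
      unfolding window_count_def lessThan_atLeast0
      by (rule sum.atLeastLessThan_concat[symmetric]) auto
    also have "(\<Sum>x\<in>{L - ?n..<L}. of_bool (s (h + int x) = c)) = window_count s ?n (h + int (L - ?n)) c"
      unfolding window_count_def using False
      by (intro sum.reindex_bij_witness[of _ "\<lambda>x. x + (L - ?n)" "\<lambda>x. x - (L - ?n)"])
        (auto simp: algebra_simps)
    also have "\<dots> = 1"
      by (rule window_count_full[OF H(1,2) inj c])
    finally have "window_count s L h c = window_count s (L - ?n) h c + 1" .
    moreover have "L div ?n = (L - ?n) div ?n + 1"
      using False n by (simp add: le_div_geq)
    ultimately show ?thesis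
      using less.IH[of "L - ?n"] False n by auto
  qed
qed

lemma window_pairs_balanced:
  assumes H: "finite H" "range s \<subseteq> H" "H \<noteq> {}"
    and inj: "\<And>h. inj_on s {h..<h + int (card H)}"
  shows "window_pairs s L h = balanced_pairs (card H) L"
proof -
  have "window_pairs s L h - balanced_pairs (card H) L = 0"
    unfolding window_pairs_defect[OF H(1,2)]
    using window_count_balanced[OF H inj, where L = L and h = h] by (intro sum.neutral) force
  then show ?thesis
    by simp
qed

text \<open>Equality forces \<open>k c \<in> {1, 2}\<close> for every colour, so all \<open>card H\<close> colours occur among the \<open>card H\<close>
  positions.\<close>

lemma window_pairs_eq_balanced_imp_inj:
  assumes H: "finite H" "range s \<subseteq> H" "H \<noteq> {}"
    and eq: "window_pairs s (card H) h = balanced_pairs (card H) (card H)"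
  shows "inj_on s {h..<h + int (card H)}"
proof -
  let ?n = "card H" and ?k = "window_count s (card H) h"
  have n: "?n > 0"
    using H by (simp add: card_gt_0_iff)
  have "(\<Sum>c\<in>H. (?k c - 1) * (?k c - 1 - 1)) = 0"
    using window_pairs_defect[OF H(1,2), of ?n h] eq n by simp
  then have k: "(?k c - 1) * (?k c - 1 - 1) = 0" if "c \<in> H" for c
    using that sum_nonneg_eq_0_iff[OF H(1) consecutive_product_nonneg, of "\<lambda>c. ?k c - 1"] by blast
  have "H \<subseteq> s ` {h..<h + int ?n}"
  proof
    fix c assume "c \<in> H"
    then have "?k c \<noteq> 0"
      using k[of c] by auto
    then have "\<not> (\<forall>x<?n. s (h + int x) \<noteq> c)"
      unfolding window_count_def by (auto intro: sum.neutral)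
    then obtain x where "x < ?n" "s (h + int x) = c"
      by blast
    then show "c \<in> s ` {h..<h + int ?n}"
      by force
  qed
  then have "s ` {h..<h + int ?n} = H"
    using H(2) by auto
  then show ?thesis
    by (intro eq_card_imp_inj_on) auto
qed

lemma has_period_add_mult:
  assumes "has_period s N"
  shows "s (i + int N * k) = s i"
proof -
  have nat: "s (i + int N * int m) = s i" for i m
  proof (induction m)
    case (Suc m)
    have "s (i + int N * int (Suc m)) = s ((i + int N * int m) + int N)"
      by (simp add: algebra_simps)
    then show ?case
      using Suc assms by (simp add: has_period_def)
  qed simp
  show ?thesis
  proof (cases k rule: int_cases2)
    case (nonpos m)
    then show ?thesis
      using nat[of "i + int N * k" m] by simp
  qed (use nat in simp)
qed

lemma has_period_multiple:
  assumes "has_period s N" "m \<ge> 1"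
  shows "has_period s (N * m)"
  using has_period_add_mult[OF assms(1), of _ "int m"] assms by (simp add: has_period_def)

text \<open>Every window of a layering without repetition among \<open>card H\<close> consecutive layers is balanced, so
  such a layering minimises all window counts at once. In the case of equality no count can be
  larger; the length \<open>card H\<close> has a positive coefficient as soon as it is at least 2, and balanced
  windows of this length have no repetition.\<close>

lemma coincidence_energy_min:
  assumes a: "a \<ge> 1 / 2" and H: "finite H" "H \<noteq> {}"
    and s: "range s \<subseteq> H" "has_period s N"
    and u: "range u \<subseteq> H" "has_period u N" "\<And>h. inj_on u {h..<h + int (card H)}"
  shows "coincidence_energy a u N \<le> coincidence_energy a s N"
    and "coincidence_energy a s N = coincidence_energy a u N \<Longrightarrow> card H \<ge> 2
      \<Longrightarrow> inj_on s {h..<h + int (card H)}"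
proof -
  let ?n = "card H"
  let ?d = "\<lambda>L h. real_of_int (window_pairs s L h) - real_of_int (window_pairs u L h)"
  have "((\<lambda>L. second_diff a L * (\<Sum>h=1..int N. real_of_int (window_pairs s L h))
        + - (second_diff a L * (\<Sum>h=1..int N. real_of_int (window_pairs u L h)))) has_sum
      ((coincidence_energy a s N + real N * diag_excess a)
        + - (coincidence_energy a u N + real N * diag_excess a))) UNIV"
    by (intro has_sum_add has_sum_uminusI coincidence_energy_eq_windows[OF a] s u)
  then have diff: "((\<lambda>L. second_diff a L * (\<Sum>h=1..int N. ?d L h))
      has_sum (coincidence_energy a s N - coincidence_energy a u N)) UNIV"
    by (simp add: sum_subtractf right_diff_distrib)
  have d: "?d L h \<ge> 0" for L h
    using window_pairs_ge[OF H(1) s(1), of L h] window_pairs_balanced[OF H(1) u(1) H(2) u(3), of L h]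
    by simp
  have nonneg: "second_diff a L * (\<Sum>h=1..int N. ?d L h) \<ge> 0" for L
    by (intro mult_nonneg_nonneg second_diff_nonneg[OF a] sum_nonneg d)
  show "coincidence_energy a u N \<le> coincidence_energy a s N"
    using has_sum_nonneg[OF diff nonneg] by simp
  assume eq: "coincidence_energy a s N = coincidence_energy a u N" and n: "?n \<ge> 2"
  have "second_diff a ?n * (\<Sum>h=1..int N. ?d ?n h) = 0"
    by (rule nonneg_has_sum_le_0D[OF diff _ nonneg]) (use eq in auto)
  then have "(\<Sum>h=1..int N. ?d ?n h) = 0"
    using second_diff_pos[OF a n] by simp
  then have d0: "?d ?n h = 0" if "h \<in> {1..int N}" for h
    using that d by (subst (asm) sum_nonneg_eq_0_iff) auto
  \<comment> \<open>the representative of \<open>h\<close> in the period \<open>{1..N}\<close>\<close>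
  define g where "g = (h - 1) mod int N + 1"
  have N: "int N > 0"
    using s(2) by (simp add: has_period_def)
  have g: "g \<in> {1..int N}"
    using pos_mod_bound[OF N, of "h - 1"] pos_mod_sign[OF N, of "h - 1"]
    unfolding g_def atLeastAtMost_iff by linarith
  have "h = g + int N * ((h - 1) div int N)"
    using mult_div_mod_eq[of "int N" "h - 1"] by (simp add: g_def)
  then have "h + int x = (g + int x) + int N * ((h - 1) div int N)" for x
    by simp
  then have "s (h + int x) = s (g + int x)" for x
    using has_period_add_mult[OF s(2)] by metis
  then have "window_pairs s ?n h = window_pairs s ?n g"
    by (simp add: window_pairs_def)
  then have "window_pairs s ?n h = balanced_pairs ?n ?n"
    using d0[OF g] window_pairs_balanced[OF H(1) u(1) H(2) u(3), of ?n g] by simp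
  then show "inj_on s {h..<h + int ?n}"
    by (rule window_pairs_eq_balanced_imp_inj[OF H(1) s(1) H(2)])
qed

lemma periodic_ext_inj_on_window:
  assumes "inj_on b {1..n}"
  shows "inj_on (periodic_ext n b) {h..<h + int n}"
proof (rule inj_onI)
  fix i j assume ij: "i \<in> {h..<h + int n}" "j \<in> {h..<h + int n}"
    and eq: "periodic_ext n b i = periodic_ext n b j"
  have n: "int n > 0"
    using ij by auto
  have "nat ((k - 1) mod int n) + 1 \<in> {1..n}" for k
    using n pos_mod_bound[OF n, of "k - 1"] pos_mod_sign[OF n, of "k - 1"] by auto
  then have "nat ((i - 1) mod int n) = nat ((j - 1) mod int n)"
    using inj_onD[OF assms, of "nat ((i - 1) mod int n) + 1" "nat ((j - 1) mod int n) + 1"] eq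
    by (simp add: periodic_ext_def)
  then have "(i - 1) mod int n = (j - 1) mod int n"
    using n by (metis nat_0_le pos_mod_sign)
  then have dvd: "int n dvd i - j"
    by (simp add: mod_eq_dvd_iff)
  have "\<bar>i - j\<bar> < int n"
    using ij by auto
  then show "i = j"
    using dvd zdvd_imp_le[of "int n" "\<bar>i - j\<bar>"] by (cases "i = j") auto
qed

lemma periodic_ext_range:
  assumes "n \<ge> 1"
  shows "range (periodic_ext n b) \<subseteq> b ` {1..n}"
proof -
  have n: "int n > 0"
    using assms by simp
  have "nat ((i - 1) mod int n) + 1 \<in> {1..n}" for i
    using n pos_mod_bound[OF n, of "i - 1"] pos_mod_sign[OF n, of "i - 1"] by auto
  then show ?thesis
    by (auto simp: periodic_ext_def)
qed

text \<open>The windows starting at \<open>h\<close> and \<open>h + 1\<close> both show every colour once and share all positions but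
  the ends, so the ends \<open>h\<close> and \<open>h + card H\<close> have the same colour.\<close>

lemma inj_on_windows_imp_periodic_ext:
  assumes H: "finite H" "range s \<subseteq> H" "H \<noteq> {}"
    and inj: "\<And>h. inj_on s {h..<h + int (card H)}"
  shows "bij_betw (\<lambda>i. s (int i)) {1..card H} H"
    and "s = periodic_ext (card H) (\<lambda>i. s (int i))"
proof -
  let ?n = "card H"
  have n: "?n > 0"
    using H by (simp add: card_gt_0_iff)
  have "s (h + int ?n) = s h" for h
  proof -
    have "s (h + int ?n) \<in> s ` {h..<h + int ?n}"
      using window_image[OF H(1,2) inj] H(2) by auto
    then obtain i where i: "i \<in> {h..<h + int ?n}" "s (h + int ?n) = s i"
      by blast
    have "i = h"
    proof (rule ccontr)
      assume "i \<noteq> h"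
      then have "h + int ?n = i"
        using i by (intro inj_onD[OF inj[of "h + 1"]]) auto
      then show False
        using i by simp
    qed
    then show ?thesis
      using i by simp
  qed
  then have per: "has_period s ?n"
    using n by (simp add: has_period_def)
  have int_img: "int ` {1..?n} = {1..<1 + int ?n}"
    using image_int_atLeastAtMost[of 1 ?n] by auto
  have "inj_on (s \<circ> int) {1..?n}"
    using inj[of 1] by (intro comp_inj_on) (simp, simp only: int_img)
  moreover have "(s \<circ> int) ` {1..?n} = H"
    using window_image[OF H(1,2) inj, of 1] by (simp only: image_comp[symmetric] int_img)
  ultimately show "bij_betw (\<lambda>i. s (int i)) {1..?n} H"
    by (simp add: bij_betw_def o_def)
  show "s = periodic_ext ?n (\<lambda>i. s (int i))"
  proof
    fix i
    have "int (nat ((i - 1) mod int ?n) + 1) + int ?n * ((i - 1) div int ?n) = i"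
      using n mult_div_mod_eq[of "int ?n" "i - 1"] by simp
    then show "s i = periodic_ext ?n (\<lambda>i. s (int i)) i"
      using has_period_add_mult[OF per, of "int (nat ((i - 1) mod int ?n) + 1)" "(i - 1) div int ?n"]
      by (simp only: periodic_ext_def)
  qed
qed

section \<open>Layerings of short period\<close>

lemma gaussian_sum_multiples:
  fixes a :: real
  assumes a: "a > 0" and k: "k \<ge> 1"
  shows "((\<lambda>j::int. exp (- (a * (real k * of_int j)\<^sup>2))) has_sum
    (\<Sum>\<^sub>\<infinity>i. exp (- (a * (of_int i)\<^sup>2)) * of_bool (int k dvd i))) UNIV"
proof -
  let ?W = "\<lambda>i::int. exp (- (a * (of_int i)\<^sup>2))"
  have inj: "inj_on (\<lambda>j. int k * j) UNIV"
    using k by (auto simp: inj_on_def)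
  have "?W summable_on range (\<lambda>j. int k * j)"
    using gaussian_summable_int[OF a] by (rule summable_on_subset) simp
  then have "((\<lambda>j::int. ?W (int k * j)) has_sum (infsum ?W (range (\<lambda>j. int k * j)))) UNIV"
    using has_sum_infsum[of ?W "range (\<lambda>j. int k * j)"] by (simp add: has_sum_reindex[OF inj] o_def)
  moreover have "infsum ?W (range (\<lambda>j. int k * j)) = (\<Sum>\<^sub>\<infinity>i. ?W i * of_bool (int k dvd i))"
    by (rule infsum_cong_neutral) auto
  ultimately show ?thesis
    by simp
qed

text \<open>A layering of period \<open>k\<close> has coincidences at least at all multiples of \<open>k\<close>, the competitor \<open>u\<close> only
  at the multiples of \<open>card H\<close>. Since \<open>k \<le> card H\<close>, comparing the \<open>j\<close>-th multiples suffices, for any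
  decreasing weight.\<close>

lemma coincidence_energy_min_short:
  assumes a: "a > 0" and H: "finite H" "H \<noteq> {}"
    and s: "has_period s k" "k \<le> card H"
    and u: "range u \<subseteq> H" "has_period u (card H)" "\<And>h. inj_on u {h..<h + int (card H)}"
  shows "coincidence_energy a u N \<le> coincidence_energy a s N"
  unfolding coincidence_energy_def
proof (rule sum_mono)
  fix h
  let ?n = "card H" and ?W = "\<lambda>i::int. exp (- (a * (of_int i)\<^sup>2))"
  have k: "k \<ge> 1"
    using s(1) by (simp add: has_period_def)
  have n: "int ?n > 0"
    using k s(2) by simp
  have "u h = u (h + i) \<longleftrightarrow> int ?n dvd i" for i
  proof
    assume "u h = u (h + i)"
    moreover have "u (h + i) = u (h + i mod int ?n)"
      using has_period_add_mult[OF u(2), of "h + i mod int ?n" "i div int ?n"] by (simp add: algebra_simps)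
    ultimately have "h = h + i mod int ?n"
      using n pos_mod_bound[OF n, of i] pos_mod_sign[OF n, of i]
      by (intro inj_onD[OF u(3)[of h]]) auto
    then show "int ?n dvd i"
      by (simp add: dvd_eq_mod_eq_0)
  qed (use has_period_add_mult[OF u(2), of h] in \<open>auto elim!: dvdE\<close>)
  then have "(\<Sum>\<^sub>\<infinity>i. ?W i * of_bool (u h = u (h + i))) = (\<Sum>\<^sub>\<infinity>i. ?W i * of_bool (int ?n dvd i))"
    by simp
  also have "\<dots> \<le> (\<Sum>\<^sub>\<infinity>i. ?W i * of_bool (int k dvd i))"
  proof (rule has_sum_mono[OF gaussian_sum_multiples gaussian_sum_multiples])
    fix j :: int
    have "(real k * of_int j)\<^sup>2 \<le> (real ?n * of_int j)\<^sup>2"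
      unfolding power_mult_distrib using s(2) by (intro mult_right_mono power_mono) auto
    then show "exp (- (a * (real ?n * of_int j)\<^sup>2)) \<le> exp (- (a * (real k * of_int j)\<^sup>2))"
      using a by simp
  qed (use a k s(2) in auto)
  also have "\<dots> \<le> (\<Sum>\<^sub>\<infinity>i. ?W i * of_bool (s h = s (h + i)))"
  proof (rule infsum_mono)
    show "(\<lambda>i. ?W i * of_bool (P i)) summable_on UNIV" for P
      using gaussian_summable_int[OF a] by (rule summable_on_comparison_test) auto
    then show "(\<lambda>i. ?W i * of_bool (s h = s (h + i))) summable_on UNIV" .
    fix i
    show "?W i * of_bool (int k dvd i) \<le> ?W i * of_bool (s h = s (h + i))"
      using has_period_add_mult[OF s(1), of h] by (auto elim!: dvdE)
  qed
  finally show "(\<Sum>\<^sub>\<infinity>i. ?W i * of_bool (u h = u (h + i))) \<le> (\<Sum>\<^sub>\<infinity>i. ?W i * of_bool (s h = s (h + i)))" .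
qed

section \<open>From layered configurations to coincidences\<close>

lemma theta_same_symmetries:
  assumes "same_symmetries \<Lambda> H" "x \<in> H" "y \<in> H" "w \<in> H" "z \<in> H" "x \<noteq> y" "w \<noteq> z"
  shows "theta \<Lambda> a (x - y) = theta \<Lambda> a (w - z)"
proof -
  obtain \<phi> where \<phi>: "bij_betw \<phi> \<Lambda> \<Lambda>" "\<And>p. p \<in> \<Lambda> \<Longrightarrow> norm (p + x - y) = norm (\<phi> p + w - z)"
    using assms unfolding same_symmetries_def by blast
  have "theta \<Lambda> a (x - y) = (\<Sum>\<^sub>\<infinity>p\<in>\<Lambda>. exp (- (a * (norm (\<phi> p + (w - z)))\<^sup>2)))"
    unfolding theta_def by (intro infsum_cong) (simp add: \<phi>(2) add_diff_eq)
  also have "\<dots> = theta \<Lambda> a (w - z)"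
    unfolding theta_def by (rule infsum_reindex_bij_betw[OF \<phi>(1)])
  finally show ?thesis .
qed

text \<open>The interaction of two layers takes only two values: \<open>\<theta>(0)\<close> for equal shifts and \<open>c\<close> for
  different ones. If \<open>H\<close> has fewer than two points, \<open>c = \<theta>(0)\<close> serves.\<close>

lemma theta_off_diagonal:
  assumes L: "is_lattice \<Lambda>" and sym: "same_symmetries \<Lambda> H" and a: "a > 0"
  obtains c where "c \<le> theta \<Lambda> a 0"
    and "\<And>x y. x \<in> H \<Longrightarrow> y \<in> H \<Longrightarrow> x \<noteq> y \<Longrightarrow> theta \<Lambda> a (x - y) = c"
    and "\<And>x y. x \<in> H \<Longrightarrow> y \<in> H \<Longrightarrow> x - y \<notin> \<Lambda> \<Longrightarrow> c < theta \<Lambda> a 0"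
proof (cases "\<exists>x\<in>H. \<exists>y\<in>H. x \<noteq> y")
  case True
  then obtain x y where xy: "x \<in> H" "y \<in> H" "x \<noteq> y"
    by blast
  show ?thesis
  proof
    show le: "theta \<Lambda> a (x - y) \<le> theta \<Lambda> a 0"
      by (rule theta_le_theta_0[OF L a])
    show const: "theta \<Lambda> a (w - z) = theta \<Lambda> a (x - y)" if "w \<in> H" "z \<in> H" "w \<noteq> z" for w z
      using that xy by (intro theta_same_symmetries[OF sym])
    show "theta \<Lambda> a (x - y) < theta \<Lambda> a 0" if "w \<in> H" "z \<in> H" "w - z \<notin> \<Lambda>" for w z
    proof -
      have "w \<noteq> z"
        using that lattice_0[OF L] by auto
      then have "theta \<Lambda> a (w - z) = theta \<Lambda> a (x - y)"
        using that by (intro const)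
      moreover have "theta \<Lambda> a (w - z) \<noteq> theta \<Lambda> a 0"
        using theta_eq_theta_0_imp_lattice[OF L a] that by blast
      ultimately show ?thesis
        using le by simp
    qed
  qed
next
  case False
  show ?thesis
  proof
    show "theta \<Lambda> a 0 \<le> theta \<Lambda> a 0"
      by simp
    show "theta \<Lambda> a (x - y) = theta \<Lambda> a 0" if "x \<in> H" "y \<in> H" "x \<noteq> y" for x y
      using False that by blast
    show "theta \<Lambda> a 0 < theta \<Lambda> a 0" if "x \<in> H" "y \<in> H" "x - y \<notin> \<Lambda>" for x y
      using False that lattice_0[OF L] by (metis diff_self)
  qed
qed

text \<open>Write \<open>\<theta>(x - y) = c + (\<theta>(0) - c) [x = y]\<close> for \<open>x, y \<in> H\<close>; the constant part of the interaction
  contributes the same energy to every layering.\<close>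

lemma energy_eq_coincidence_energy:
  fixes \<alpha> t c :: real
  assumes pos: "\<alpha> > 0" "t > 0"
    and c: "\<forall>x\<in>H. \<forall>y\<in>H. x \<noteq> y \<longrightarrow> theta \<Lambda> (pi * \<alpha>) (x - y) = c"
    and s: "range s \<subseteq> H" "has_period s N"
  shows "energy \<alpha> \<Lambda> t s = c * (\<Sum>\<^sub>\<infinity>i::int. exp (- (pi * \<alpha> * t\<^sup>2 * (of_int i)\<^sup>2)))
    + (theta \<Lambda> (pi * \<alpha>) 0 - c) / real N * coincidence_energy (pi * \<alpha> * t\<^sup>2) s N"
proof -
  let ?C = "theta \<Lambda> (pi * \<alpha>) 0" and ?W = "\<lambda>i::int. exp (- (pi * \<alpha> * t\<^sup>2 * (of_int i)\<^sup>2))"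
  have mem: "s i \<in> H" for i
    using s(1) by blast
  have W: "?W summable_on UNIV"
    using pos by (intro gaussian_summable_int) simp
  have layer: "layer_energy \<alpha> \<Lambda> t s h
      = c * infsum ?W UNIV + (?C - c) * (\<Sum>\<^sub>\<infinity>i. ?W i * of_bool (s h = s (h + i)))" for h
  proof -
    have inner: "(\<Sum>\<^sub>\<infinity>p\<in>\<Lambda>. exp (- pi * \<alpha> * ((of_int (h - k))\<^sup>2 * t\<^sup>2 + (norm (p + s h - s k))\<^sup>2)))
        = ?W (k - h) * theta \<Lambda> (pi * \<alpha>) (s h - s k)" for k
    proof -
      have "- pi * \<alpha> * ((of_int (h - k))\<^sup>2 * t\<^sup>2 + (norm (p + s h - s k))\<^sup>2)
          = - (pi * \<alpha> * t\<^sup>2 * (of_int (k - h))\<^sup>2) + - (pi * \<alpha> * (norm (p + (s h - s k)))\<^sup>2)" for p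
        by (simp add: algebra_simps power2_eq_square)
      then show ?thesis
        by (simp only: exp_add infsum_cmult_right' theta_def)
    qed
    have bij: "bij_betw (\<lambda>i. h + i) UNIV UNIV"
      by (rule bij_betwI[where g = "\<lambda>k. k - h"]) auto
    have "layer_energy \<alpha> \<Lambda> t s h = (\<Sum>\<^sub>\<infinity>k. ?W (k - h) * theta \<Lambda> (pi * \<alpha>) (s h - s k))"
      unfolding layer_energy_def inner ..
    also have "\<dots> = (\<Sum>\<^sub>\<infinity>i. ?W i * theta \<Lambda> (pi * \<alpha>) (s h - s (h + i)))"
      by (subst infsum_reindex_bij_betw[OF bij, symmetric]) simp
    also have "\<dots> = (\<Sum>\<^sub>\<infinity>i. c * ?W i + (?C - c) * (?W i * of_bool (s h = s (h + i))))"
      by (intro infsum_cong) (auto simp: c mem algebra_simps)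
    also have "\<dots> = c * infsum ?W UNIV + (?C - c) * (\<Sum>\<^sub>\<infinity>i. ?W i * of_bool (s h = s (h + i)))"
    proof -
      have "(\<lambda>i. ?W i * of_bool (s h = s (h + i))) summable_on UNIV"
        using W by (rule summable_on_comparison_test) auto
      then show ?thesis
        using W by (subst infsum_add) (auto intro: summable_on_cmult_right simp: infsum_cmult_right')
    qed
    finally show ?thesis .
  qed
  have "real N > 0"
    using s(2) by (simp add: has_period_def)
  then show ?thesis
    unfolding energy_eq_period_energy[OF s(2)] period_energy_def layer sum.distrib
      sum_distrib_left[symmetric] coincidence_energy_def[symmetric]
    by (simp add: field_simps)
qed

text \<open>In the degenerate case where all shifts agree modulo the lattice, every layering is a
  minimiser, but there is only one layered configuration.\<close>

lemma layered_eq_if_differences_in_lattice: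
  assumes L: "is_lattice \<Lambda>" and H: "\<And>x y. x \<in> H \<Longrightarrow> y \<in> H \<Longrightarrow> x - y \<in> \<Lambda>"
    and su: "range s \<subseteq> H" "range u \<subseteq> H"
  shows "layered \<Lambda> t s = layered \<Lambda> t u"
proof -
  have "layered \<Lambda> t s \<subseteq> layered \<Lambda> t u" if "range s \<subseteq> H" "range u \<subseteq> H" for s u
  proof
    fix z assume "z \<in> layered \<Lambda> t s"
    then obtain k p where z: "z = (p + s k, of_int k * t)" "p \<in> \<Lambda>"
      unfolding layered_def by blast
    have "p + (s k - u k) \<in> \<Lambda>"
      using that z(2) by (intro lattice_add[OF L] H) auto
    moreover have "p + s k = (p + (s k - u k)) + u k"
      by simp
    ultimately show "z \<in> layered \<Lambda> t u"
      unfolding layered_def z(1) by blast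
  qed
  then show ?thesis
    using su by blast
qed

lemma periodic_ext_of_bij:
  assumes H: "finite H" "H \<noteq> {}" and b: "bij_betw b {1..card H} H"
  shows "range (periodic_ext (card H) b) \<subseteq> H"
    and "has_period (periodic_ext (card H) b) (card H)"
    and "\<And>h. inj_on (periodic_ext (card H) b) {h..<h + int (card H)}"
proof -
  have n: "card H \<ge> 1"
    using H by (simp add: card_gt_0_iff Suc_le_eq)
  show "range (periodic_ext (card H) b) \<subseteq> H"
    using periodic_ext_range[OF n, of b] b by (simp add: bij_betw_def)
  show "has_period (periodic_ext (card H) b) (card H)"
    by (rule has_period_periodic_ext[OF n])
  show "inj_on (periodic_ext (card H) b) {h..<h + int (card H)}" for h
    using b by (intro periodic_ext_inj_on_window) (simp add: bij_betw_def)
qed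

lemma short_layering_iff:
  "short_layering H s \<longleftrightarrow> range s \<subseteq> H \<and> (\<exists>k \<le> card H. has_period s k)"
proof
  assume "short_layering H s"
  then obtain k b' where k: "1 \<le> k" "k \<le> card H" and b': "b' ` {0..<int k} \<subseteq> H"
    and s: "\<And>i. s i = b' (i mod int k)"
    unfolding short_layering_def by blast
  have "i mod int k \<in> {0..<int k}" for i
    using k by simp
  then have "range s \<subseteq> H"
    using b' s by auto
  moreover have "has_period s k"
    using k s by (simp add: has_period_def)
  ultimately show "range s \<subseteq> H \<and> (\<exists>k \<le> card H. has_period s k)"
    using k by blast
next
  assume "range s \<subseteq> H \<and> (\<exists>k \<le> card H. has_period s k)"
  then obtain k where k: "range s \<subseteq> H" "k \<le> card H" "has_period s k"
    by blast
  have "s i = s (i mod int k)" for i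
    using has_period_add_mult[OF k(3), of "i mod int k" "i div int k"] by simp
  moreover have "1 \<le> k"
    using k(3) by (simp add: has_period_def)
  ultimately show "short_layering H s"
    unfolding short_layering_def using k by (intro exI[of _ k] conjI exI[of _ s]) auto
qed

theorem theorem1p1:
  fixes \<Lambda> H :: "(real ^ 'n) set" and t :: real
  assumes "is_lattice \<Lambda>"
    and "finite H" and "H \<noteq> {}"
    and "same_symmetries \<Lambda> H"
    and "t > 0"
  shows
    "(\<forall>\<alpha> \<ge> 1 / (2 * pi * t\<^sup>2). \<forall>b. bij_betw b {1..card H} H \<longrightarrow>
        is_arg_min (energy \<alpha> \<Lambda> t) (periodic_layering H) (periodic_ext (card H) b)) \<and>
     (\<forall>\<alpha> > 1 / (2 * pi * t\<^sup>2). \<forall>s.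
        is_arg_min (energy \<alpha> \<Lambda> t) (periodic_layering H) s \<longrightarrow>
        (\<exists>b. bij_betw b {1..card H} H \<and>
             layered \<Lambda> t s = layered \<Lambda> t (periodic_ext (card H) b))) \<and>
     (\<forall>\<alpha> > 0. \<forall>b. bij_betw b {1..card H} H \<longrightarrow>
        is_arg_min (energy \<alpha> \<Lambda> t) (short_layering H) (periodic_ext (card H) b))"
proof (intro conjI allI impI)
  note L = assms(1) and H = assms(2,3) and sym = assms(4) and t = assms(5)
  let ?n = "card H"
  have n: "?n \<ge> 1"
    using H by (simp add: card_gt_0_iff Suc_le_eq)
  have large: "\<alpha> > 0 \<and> pi * \<alpha> * t\<^sup>2 \<ge> 1 / 2" if "\<alpha> \<ge> 1 / (2 * pi * t\<^sup>2)" for \<alpha>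
  proof -
    have "0 < 1 / (2 * pi * t\<^sup>2)"
      using t by simp
    then have "\<alpha> > 0"
      using that by linarith
    then show ?thesis
      using that t by (simp add: field_simps)
  qed
  have min1: "is_arg_min (energy \<alpha> \<Lambda> t) (periodic_layering H) (periodic_ext ?n b)"
    if \<alpha>: "\<alpha> \<ge> 1 / (2 * pi * t\<^sup>2)" and b: "bij_betw b {1..?n} H" for \<alpha> b
  proof -
    note u = periodic_ext_of_bij[OF H b]
    have pos: "\<alpha> > 0" "pi * \<alpha> > 0" and a: "pi * \<alpha> * t\<^sup>2 \<ge> 1 / 2"
      using large[OF \<alpha>] by auto
    obtain c where c: "c \<le> theta \<Lambda> (pi * \<alpha>) 0"
      "\<forall>x\<in>H. \<forall>y\<in>H. x \<noteq> y \<longrightarrow> theta \<Lambda> (pi * \<alpha>) (x - y) = c"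
      using theta_off_diagonal[OF L sym pos(2)] by metis
    have "energy \<alpha> \<Lambda> t (periodic_ext ?n b) \<le> energy \<alpha> \<Lambda> t s" if s: "periodic_layering H s" for s
    proof -
      obtain P where P: "range s \<subseteq> H" "has_period s P"
        using s by (auto simp: periodic_layering_def)
      \<comment> \<open>the energies are compared over a common period\<close>
      have per: "has_period s (P * ?n)" "has_period (periodic_ext ?n b) (P * ?n)"
        using has_period_multiple[OF P(2) n] has_period_multiple[OF u(2), of P] P(2)
        by (auto simp: has_period_def mult.commute)
      show ?thesis
        unfolding energy_eq_coincidence_energy[OF pos(1) t c(2) P(1) per(1)]
          energy_eq_coincidence_energy[OF pos(1) t c(2) u(1) per(2)]
        using c(1)
        by (intro add_left_mono mult_left_mono
            coincidence_energy_min(1)[OF a H P(1) per(1) u(1) per(2) u(3)]) auto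
    qed
    moreover have "periodic_layering H (periodic_ext ?n b)"
      using u by (auto simp: periodic_layering_def)
    ultimately show ?thesis
      by (auto simp: is_arg_min_def not_less)
  qed
  then show "is_arg_min (energy \<alpha> \<Lambda> t) (periodic_layering H) (periodic_ext ?n b)"
    if "\<alpha> \<ge> 1 / (2 * pi * t\<^sup>2)" and "bij_betw b {1..?n} H" for \<alpha> b
    using that by blast
  show "\<exists>b. bij_betw b {1..?n} H \<and> layered \<Lambda> t s = layered \<Lambda> t (periodic_ext ?n b)"
    if \<alpha>: "\<alpha> > 1 / (2 * pi * t\<^sup>2)" and s: "is_arg_min (energy \<alpha> \<Lambda> t) (periodic_layering H) s" for \<alpha> s
  proof -
    have pos: "\<alpha> > 0" "pi * \<alpha> > 0" and a: "pi * \<alpha> * t\<^sup>2 \<ge> 1 / 2"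
      using large[of \<alpha>] \<alpha> by auto
    obtain b where b: "bij_betw b {1..?n} H"
      using ex_bij_betw_nat_finite_1[OF H(1)] by blast
    note u = periodic_ext_of_bij[OF H b]
    obtain P where P: "range s \<subseteq> H" "has_period s P"
      using s by (auto simp: is_arg_min_def periodic_layering_def)
    show ?thesis
    \<comment> \<open>if all differences are lattice points, any enumeration \<open>b\<close> of \<open>H\<close> will do\<close>
    proof (cases "\<forall>x\<in>H. \<forall>y\<in>H. x - y \<in> \<Lambda>")
      case True
      then show ?thesis
        using layered_eq_if_differences_in_lattice[OF L _ P(1) u(1)] b by blast
    next
      case False
      then obtain x y where xy: "x \<in> H" "y \<in> H" "x - y \<notin> \<Lambda>"
        by blast
      then have "x \<noteq> y"
        using lattice_0[OF L] by auto
      then have n2: "?n \<ge> 2"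
        using xy card_mono[OF H(1), of "{x, y}"] by simp
      obtain c where c: "c < theta \<Lambda> (pi * \<alpha>) 0"
        "\<forall>x\<in>H. \<forall>y\<in>H. x \<noteq> y \<longrightarrow> theta \<Lambda> (pi * \<alpha>) (x - y) = c"
        using theta_off_diagonal[OF L sym pos(2)] xy by metis
      have per: "has_period s (P * ?n)" "has_period (periodic_ext ?n b) (P * ?n)"
        using has_period_multiple[OF P(2) n] has_period_multiple[OF u(2), of P] P(2)
        by (auto simp: has_period_def mult.commute)
      have "energy \<alpha> \<Lambda> t s \<le> energy \<alpha> \<Lambda> t (periodic_ext ?n b)"
        using s u by (force simp: is_arg_min_def periodic_layering_def not_less)
      moreover have "(theta \<Lambda> (pi * \<alpha>) 0 - c) / real (P * ?n) > 0"
        using c(1) per(1) by (simp add: has_period_def)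
      ultimately have "coincidence_energy (pi * \<alpha> * t\<^sup>2) s (P * ?n)
          \<le> coincidence_energy (pi * \<alpha> * t\<^sup>2) (periodic_ext ?n b) (P * ?n)"
        unfolding energy_eq_coincidence_energy[OF pos(1) t c(2) P(1) per(1)]
          energy_eq_coincidence_energy[OF pos(1) t c(2) u(1) per(2)]
        by (simp only: add_le_cancel_left mult_le_cancel_left_pos)
      then have inj: "inj_on s {h..<h + int ?n}" for h
        using n2 by (intro coincidence_energy_min(2)[OF a H P(1) per(1) u(1) per(2) u(3)] antisym
            coincidence_energy_min(1)[OF a H P(1) per(1) u(1) per(2) u(3)])
      show ?thesis
        using inj_on_windows_imp_periodic_ext[OF H(1) P(1) H(2) inj] by metis
    qed
  qed
  show "is_arg_min (energy \<alpha> \<Lambda> t) (short_layering H) (periodic_ext ?n b)"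
    if \<alpha>: "\<alpha> > 0" and b: "bij_betw b {1..?n} H" for \<alpha> b
  proof -
    note u = periodic_ext_of_bij[OF H b]
    have pos: "pi * \<alpha> > 0" "pi * \<alpha> * t\<^sup>2 > 0"
      using \<alpha> t by auto
    obtain c where c: "c \<le> theta \<Lambda> (pi * \<alpha>) 0"
      "\<forall>x\<in>H. \<forall>y\<in>H. x \<noteq> y \<longrightarrow> theta \<Lambda> (pi * \<alpha>) (x - y) = c"
      using theta_off_diagonal[OF L sym pos(1)] by metis
    have "energy \<alpha> \<Lambda> t (periodic_ext ?n b) \<le> energy \<alpha> \<Lambda> t s" if s: "short_layering H s" for s
    proof -
      obtain k where k: "range s \<subseteq> H" "has_period s k" "k \<le> ?n"
        using s by (auto simp: short_layering_iff)
      have per: "has_period s (k * ?n)" "has_period (periodic_ext ?n b) (k * ?n)"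
        using has_period_multiple[OF k(2) n] has_period_multiple[OF u(2), of k] k(2)
        by (auto simp: has_period_def mult.commute)
      show ?thesis
        unfolding energy_eq_coincidence_energy[OF \<alpha> t c(2) k(1) per(1)]
          energy_eq_coincidence_energy[OF \<alpha> t c(2) u(1) per(2)]
        using c(1)
        by (intro add_left_mono mult_left_mono coincidence_energy_min_short[OF pos(2) H k(2,3) u]) auto
    qed
    moreover have "short_layering H (periodic_ext ?n b)"
      using u by (auto simp: short_layering_iff)
    ultimately show ?thesis
      by (auto simp: is_arg_min_def not_less)
  qed
qed

end
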